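(* Let $\mathcal{H}$ be a nonzero Hilbert space of finite dimension $n$. Then an irreducible solution $(\mathcal{A},J)$ in $\mathcal{H}$ with $Z(\mathcal{A}_{\mathbb{C}})=\mathbb{C}\oplus\mathbb{C}$ exists if and only if $n=2k^2$ is twice a square. It is given (up to unitary equivalence) by $\mathcal{A}_{\mathbb{C}}=M_k(\mathbb{C})\oplus M_k(\mathbb{C})$ acting by left multiplication on itself, i.e. on $\mathcal{H}=M_k(\mathbb{C})\oplus M_k(\mathbb{C})$ with the Hilbert–Schmidt inner product, and the antilinear involution $$J(x,y)=(y^*,x^* )\qquad\forall x,y\in M_k(\mathbb{C}).$$
   Context: Let $\mathcal{H}$ be a finite dimensional complex Hilbert space. An irreducible solution is a pair $(\mathcal{A},J)$ where $J$ is an antiunitary operator in $\mathcal{H}$ with $J^2=1$ and $\mathcal{A}$ is a (unital) involutive algebra over $\mathbb{R}$ of operators in $\mathcal{H}$ such that, with $x^0=Jx^*J^{-1}$, $$[x,y^0]=0\qquad\forall x,y\in\mathcal{A},$$ and: (1) the action of $\mathcal{A}$ has a separating vector, i.e. there is $\xi\in\mathcal{H}$ with $\mathcal{A}'\xi=\mathcal{H}$, where $\mathcal{A}'$ is the commutant of $\mathcal{A}$; (2) the representation of $\mathcal{A}$ and $J$ in $\mathcal{H}$ is irreducible: no non-trivial (i.e. $\neq0,1$) projection $e\in\mathcal{L}(\mathcal{H})$ commutes with $\mathcal{A}$ and $J$. $\mathcal{A}_{\mathbb{C}}$ denotes the complex linear span of $\mathcal{A}$ in the algebra $\mathcal{L}(\mathcal{H})$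 of all operators in $\mathcal{H}$; it is a complex involutive algebra. $Z(\cdot)$ denotes the center. *)

theory Defs
  imports
    Complex_Main
    "HOL-Library.Function_Algebras"
    "Jordan_Normal_Form.Schur_Decomposition"
begin

text \<open>
  A finite-dimensional complex Hilbert space is given by a complex vector space structure
  \<open>scale\<close> and a Hermitian inner product \<open>ip\<close> on a type (completeness is automatic in finite
  dimension). The inner product is antilinear in its first and linear in its second argument.
\<close>

locale finite_dim_hilbert_space = vector_space scale
  for scale :: "complex \<Rightarrow> 'h::ab_group_add \<Rightarrow> 'h" +
  fixes ip :: "'h \<Rightarrow> 'h \<Rightarrow> complex"
  assumes finite_dim: "\<exists>B. finite B \<and> span B = UNIV"
    and ip_add_right: "ip x (y + z) = ip x y + ip x z"
    and ip_scale_right: "ip x (scale c y) = c * ip x y"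
    and ip_commute: "ip x y = cnj (ip y x)"
    and ip_pos: "x \<noteq> 0 \<Longrightarrow> Re (ip x x) > 0"
begin

definition operators :: "('h \<Rightarrow> 'h) set" where
  "operators = {T. Vector_Spaces.linear scale scale T}"

text \<open>On \<open>operators\<close> the adjoint exists by finite dimensionality and is unique by
  nondegeneracy of \<open>ip\<close>.\<close>

definition adj :: "('h \<Rightarrow> 'h) \<Rightarrow> 'h \<Rightarrow> 'h" where
  "adj T = (THE S. \<forall>x y. ip (T x) y = ip x (S y))"

definition antiunitary :: "('h \<Rightarrow> 'h) \<Rightarrow> bool" where
  "antiunitary J \<longleftrightarrow>
     bij J \<and>
     (\<forall>x y. J (x + y) = J x + J y) \<and>
     (\<forall>c x. J (scale c x) = scale (cnj c) (J x)) \<and>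
     (\<forall>x y. ip (J x) (J y) = ip y x)"

definition op_scale :: "complex \<Rightarrow> ('h \<Rightarrow> 'h) \<Rightarrow> 'h \<Rightarrow> 'h" where
  "op_scale c T = (\<lambda>v. scale c (T v))"

text \<open>Unital: the unit of the algebra is the identity operator. The ambient additive group
  of all functions carries pointwise addition.\<close>

definition real_involutive_algebra :: "('h \<Rightarrow> 'h) set \<Rightarrow> bool" where
  "real_involutive_algebra A \<longleftrightarrow>
     A \<subseteq> operators \<and>
     Modules.module.subspace (\<lambda>r::real. op_scale (complex_of_real r)) A \<and>
     id \<in> A \<and>
     (\<forall>x\<in>A. \<forall>y\<in>A. x \<circ> y \<in> A) \<and>
     (\<forall>x\<in>A. adj x \<in> A)"

definition opposite :: "('h \<Rightarrow> 'h) \<Rightarrow> ('h \<Rightarrow> 'h) \<Rightarrow> 'h \<Rightarrow> 'h" where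
  "opposite J x = J \<circ> adj x \<circ> inv_into UNIV J"

definition commutant :: "('h \<Rightarrow> 'h) set \<Rightarrow> ('h \<Rightarrow> 'h) set" where
  "commutant A = {T \<in> operators. \<forall>x\<in>A. T \<circ> x = x \<circ> T}"

definition separating :: "('h \<Rightarrow> 'h) set \<Rightarrow> 'h \<Rightarrow> bool" where
  "separating A \<xi> \<longleftrightarrow> (\<lambda>T. T \<xi>) ` commutant A = UNIV"

definition projection :: "('h \<Rightarrow> 'h) \<Rightarrow> bool" where
  "projection e \<longleftrightarrow> e \<in> operators \<and> e \<circ> e = e \<and> adj e = e"

definition irreducible_rep :: "('h \<Rightarrow> 'h) set \<Rightarrow> ('h \<Rightarrow> 'h) \<Rightarrow> bool" where
  "irreducible_rep A J \<longleftrightarrow>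
     (\<forall>e. projection e \<and> (\<forall>x\<in>A. e \<circ> x = x \<circ> e) \<and> e \<circ> J = J \<circ> e
        \<longrightarrow> e = (\<lambda>v. 0) \<or> e = id)"

definition irreducible_solution :: "('h \<Rightarrow> 'h) set \<Rightarrow> ('h \<Rightarrow> 'h) \<Rightarrow> bool" where
  "irreducible_solution A J \<longleftrightarrow>
     antiunitary J \<and> J \<circ> J = id \<and>
     real_involutive_algebra A \<and>
     (\<forall>x\<in>A. \<forall>y\<in>A. x \<circ> opposite J y = opposite J y \<circ> x) \<and>
     (\<exists>\<xi>. separating A \<xi>) \<and>
     irreducible_rep A J"

definition complex_span :: "('h \<Rightarrow> 'h) set \<Rightarrow> ('h \<Rightarrow> 'h) set" where
  "complex_span A = Modules.module.span op_scale A"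

definition center :: "('h \<Rightarrow> 'h) set \<Rightarrow> ('h \<Rightarrow> 'h) set" where
  "center A = {z \<in> A. \<forall>x\<in>A. z \<circ> x = x \<circ> z}"

text \<open>\<open>Z\<close> is isomorphic, as a unital complex involutive algebra, to the direct sum of two
  copies of the complex numbers (with componentwise operations).\<close>

definition isomorphic_C_plus_C :: "('h \<Rightarrow> 'h) set \<Rightarrow> bool" where
  "isomorphic_C_plus_C Z \<longleftrightarrow>
     (\<exists>\<phi> :: complex \<times> complex \<Rightarrow> 'h \<Rightarrow> 'h.
        bij_betw \<phi> UNIV Z \<and>
        (\<forall>a b c d. \<phi> (a + c, b + d) = (\<lambda>v. \<phi> (a, b) v + \<phi> (c, d) v)) \<and>
        (\<forall>t a b. \<phi> (t * a, t * b) = op_scale t (\<phi> (a, b))) \<and>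
        (\<forall>a b c d. \<phi> (a * c, b * d) = \<phi> (a, b) \<circ> \<phi> (c, d)) \<and>
        \<phi> (1, 1) = id \<and>
        (\<forall>a b. \<phi> (cnj a, cnj b) = adj (\<phi> (a, b))))"

definition irreducible_solution_C_plus_C :: "('h \<Rightarrow> 'h) set \<Rightarrow> ('h \<Rightarrow> 'h) \<Rightarrow> bool" where
  "irreducible_solution_C_plus_C A J \<longleftrightarrow>
     irreducible_solution A J \<and> isomorphic_C_plus_C (center (complex_span A))"

end

type_synonym mat_pair = "complex mat \<times> complex mat"

definition mat_pairs :: "nat \<Rightarrow> mat_pair set" where
  "mat_pairs k = carrier_mat k k \<times> carrier_mat k k"

definition mat_trace :: "complex mat \<Rightarrow> complex" where
  "mat_trace M = (\<Sum>i<dim_row M. M $$ (i, i))"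

definition hilbert_schmidt :: "mat_pair \<Rightarrow> mat_pair \<Rightarrow> complex" where
  "hilbert_schmidt = (\<lambda>(x, y) (x', y').
     mat_trace (mat_adjoint x * x') + mat_trace (mat_adjoint y * y'))"

definition left_mult :: "mat_pair \<Rightarrow> mat_pair \<Rightarrow> mat_pair" where
  "left_mult = (\<lambda>(a, b) (x, y). (a * x, b * y))"

definition swap_adjoint :: "mat_pair \<Rightarrow> mat_pair" where
  "swap_adjoint = (\<lambda>(x, y). (mat_adjoint y, mat_adjoint x))"

context finite_dim_hilbert_space
begin

definition unitary_onto_mat_pairs :: "nat \<Rightarrow> ('h \<Rightarrow> mat_pair) \<Rightarrow> bool" where
  "unitary_onto_mat_pairs k U \<longleftrightarrow>
     bij_betw U UNIV (mat_pairs k) \<and>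
     (\<forall>v w. U (v + w) = (fst (U v) + fst (U w), snd (U v) + snd (U w))) \<and>
     (\<forall>c v. U (scale c v) = (c \<cdot>\<^sub>m fst (U v), c \<cdot>\<^sub>m snd (U v))) \<and>
     (\<forall>v w. hilbert_schmidt (U v) (U w) = ip v w)"

end

text \<open>For a bijection \<open>U\<close> from the Hilbert space onto the pairs of \<open>k \<times> k\<close> matrices, the
  operators \<open>U\<inverse> L(a,b) U\<close> and \<open>U\<inverse> J U\<close>, where \<open>L(a,b)\<close> is left multiplication and
  \<open>J(x,y) = (y*,x*)\<close>. Here \<open>inv_into UNIV U\<close> is applied only to values in the range of \<open>U\<close>.\<close>

definition model_algebra :: "nat \<Rightarrow> ('h \<Rightarrow> mat_pair) \<Rightarrow> ('h \<Rightarrow> 'h) set" where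
  "model_algebra k U = (\<lambda>m. inv_into UNIV U \<circ> left_mult m \<circ> U) ` mat_pairs k"

definition model_J :: "('h \<Rightarrow> mat_pair) \<Rightarrow> 'h \<Rightarrow> 'h" where
  "model_J U = inv_into UNIV U \<circ> swap_adjoint \<circ> U"

end

theory Submission
  imports Defs "Jordan_Normal_Form.Spectral_Radius"
begin

text \<open>
  Let \<open>M = A\<^sub>\<complex>\<close> and let \<open>e, f\<close> be the two minimal central projections of \<open>M\<close>. Since \<open>e JeJ\<close> is a
  projection commuting with \<open>M\<close> and \<open>J\<close>, irreducibility gives \<open>e JeJ = 0\<close>; likewise \<open>f JfJ = 0\<close>,
  and hence \<open>JeJ = f\<close>. For a subspace \<open>S\<close> of \<open>eH\<close> invariant under \<open>M\<close> and \<open>JMJ\<close>, with orthogonal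
  projection \<open>g\<close>, the projection \<open>g + JgJ\<close> commutes with \<open>M\<close> and \<open>J\<close>, so \<open>S\<close> is \<open>0\<close> or \<open>eH\<close>.

  Choose projections \<open>p\<close> in \<open>eM\<close> and \<open>q\<close> in \<open>fM\<close> with \<open>pMp = \<complex>p\<close> and \<open>qMq = \<complex>q\<close>. The projections
  \<open>p\<close> and \<open>JqJ\<close> commute and their product is nonzero; let \<open>\<xi>\<close> be a unit vector in its range. Let
  \<open>u\<^sub>i\<close> in \<open>Mp\<close> and \<open>w\<^sub>j\<close> in \<open>Mq\<close> be such that \<open>u\<^sub>i \<xi>\<close> and \<open>w\<^sub>j J\<xi>\<close> are orthonormal bases of the cyclic
  spaces \<open>M\<xi>\<close> and \<open>MJ\<xi>\<close>. Then the vectors \<open>u\<^sub>i J w\<^sub>j J\<xi>\<close> form an orthonormal basis of \<open>eH\<close>, on which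
  \<open>eM\<close> acts as all left multiplications on \<open>k \<times> l\<close> matrices, and \<open>J\<close> carries it to such a basis of \<open>fH\<close>.
  A separating vector forces \<open>k\<^sup>2 \<le> kl\<close> and \<open>l\<^sup>2 \<le> kl\<close>, so \<open>k = l\<close>.
\<close>

section \<open>Operators on a finite-dimensional Hilbert space\<close>

context finite_dim_hilbert_space
begin

lemma ip_add_left: "ip (x + y) z = ip x z + ip y z"
  by (metis complex_cnj_add ip_add_right ip_commute)

lemma ip_scale_left: "ip (scale c x) y = cnj c * ip x y"
  by (metis complex_cnj_mult ip_commute ip_scale_right)

lemma ip_zero_right [simp]: "ip x 0 = 0"
  using ip_add_right[of x 0 0] by simp

lemma ip_zero_left [simp]: "ip 0 x = 0"
  using ip_add_left[of 0 0 x] by simp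

lemma ip_minus_right: "ip x (y - z) = ip x y - ip x z"
  using ip_add_right[of x "y - z" z] by (simp add: algebra_simps)

lemma ip_sum_right: "ip x (sum f I) = (\<Sum>i\<in>I. ip x (f i))"
  by (induction I rule: infinite_finite_induct) (auto simp: ip_add_right)

lemma ip_sum_left: "ip (sum f I) x = (\<Sum>i\<in>I. ip (f i) x)"
  by (induction I rule: infinite_finite_induct) (auto simp: ip_add_left)

lemma ip_self_eq_0_iff [simp]: "ip x x = 0 \<longleftrightarrow> x = 0"
  using ip_pos[of x] by (cases "x = 0") auto

lemma ip_self_real: "ip x x = complex_of_real (Re (ip x x))"
  using ip_commute[of x x] by (metis Reals_cnj_iff complex_is_Real_iff of_real_Re)

lemma ip_eqI: "(\<And>x. ip x y = ip x z) \<Longrightarrow> y = z"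
  using ip_minus_right[of "y - z" y z] by (metis diff_self ip_self_eq_0_iff eq_iff_diff_eq_0)

lemma unit_multiple:
  assumes "x \<noteq> 0"
  obtains c where "c \<noteq> 0" "ip (scale c x) (scale c x) = 1"
proof
  let ?r = "Re (ip x x)"
  let ?c = "complex_of_real (1 / sqrt ?r)"
  have r: "?r > 0" by (rule ip_pos[OF assms])
  then show "?c \<noteq> 0" by simp
  have "ip (scale ?c x) (scale ?c x) = complex_of_real (1 / sqrt ?r * (1 / sqrt ?r) * ?r)"
    by (subst ip_scale_left, subst ip_scale_right, subst ip_self_real)
      (simp only: complex_cnj_complex_of_real of_real_mult mult.assoc)
  then show "ip (scale ?c x) (scale ?c x) = 1"
    using r by simp
qed

section \<open>Orthonormal families, linear independence and orthonormal bases of subspaces\<close>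

definition orthonormal :: "'i set \<Rightarrow> ('i \<Rightarrow> 'h) \<Rightarrow> bool" where
  "orthonormal I f \<longleftrightarrow> (\<forall>i\<in>I. \<forall>j\<in>I. ip (f i) (f j) = (if i = j then 1 else 0))"

lemma orthonormal_sum:
  assumes "orthonormal I f" "finite I" "j \<in> I"
  shows "ip (f j) (\<Sum>i\<in>I. scale (c i) (f i)) = c j"
proof -
  have "ip (f j) (\<Sum>i\<in>I. scale (c i) (f i)) = (\<Sum>i\<in>I. if i = j then c i else 0)"
    unfolding ip_sum_right
    by (rule sum.cong) (use assms in \<open>auto simp: orthonormal_def ip_scale_right\<close>)
  then show ?thesis
    using assms by simp
qed

text \<open>Steinitz's bound for indexed families. It caps the length of orthonormal families and
  later yields \<open>k * k \<le> k * l\<close>.\<close>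

lemma independent_family_card_le:
  assumes fin: "finite I" "finite T"
    and span: "f ` I \<subseteq> span T"
    and indep: "\<And>c i. (\<Sum>i\<in>I. scale (c i) (f i)) = 0 \<Longrightarrow> i \<in> I \<Longrightarrow> c i = 0"
  shows "card I \<le> card T"
proof -
  have inj: "inj_on f I"
  proof (rule inj_onI, rule ccontr)
    fix i j assume ij: "i \<in> I" "j \<in> I" "f i = f j" "i \<noteq> j"
    \<comment> \<open>Two equal members would satisfy a relation with coefficients 1 and -1.\<close>
    let ?c = "\<lambda>m. if m = i then 1 else if m = j then - 1 else (0::complex)"
    have "(\<Sum>m\<in>I. scale (?c m) (f m)) = (\<Sum>m\<in>{i, j}. scale (?c m) (f m))"
      by (rule sum.mono_neutral_right) (use ij fin in auto)
    also have "\<dots> = 0" using ij by simp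
    finally have "?c i = 0" using indep[of ?c i] ij by blast
    then show False by simp
  qed
  have "independent (f ` I)"
  proof
    assume "dependent (f ` I)"
    then obtain u i where u: "i \<in> I" "u (f i) \<noteq> 0" "(\<Sum>v\<in>f ` I. scale (u v) v) = 0"
      unfolding dependent_finite[OF finite_imageI[OF fin(1)]] by auto
    then have "(\<Sum>i\<in>I. scale (u (f i)) (f i)) = 0"
      by (simp add: sum.reindex[OF inj])
    with indep[of "\<lambda>i. u (f i)" i] u show False by blast
  qed
  with independent_span_bound[OF fin(2) _ span] have "card (f ` I) \<le> card T"
    by blast
  then show ?thesis
    by (simp add: card_image[OF inj])
qed

lemma orthonormal_coeff_0:
  assumes "orthonormal I f" "finite I" "(\<Sum>i\<in>I. scale (c i) (f i)) = 0" "i \<in> I"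
  shows "c i = 0"
  using orthonormal_sum[OF assms(1,2,4), of c] assms(3) by simp

lemma orthonormal_expand:
  assumes on: "orthonormal I f" and fin: "finite I" and v: "v \<in> span (f ` I)"
  shows "v = (\<Sum>i\<in>I. scale (ip (f i) v) (f i))"
  using v
proof (induction v rule: span_induct)
  case base
  show ?case
    unfolding subspace_def
    by (auto simp: ip_add_right ip_scale_right scale_left_distrib sum.distrib
        simp flip: scale_scale scale_sum_right)
next
  case (step x)
  then obtain j where j: "j \<in> I" "x = f j" by auto
  have "(\<Sum>i\<in>I. scale (ip (f i) x) (f i)) = (\<Sum>i\<in>I. if i = j then f i else 0)"
    by (rule sum.cong) (use on j in \<open>auto simp: orthonormal_def\<close>)
  then show ?case using j fin by simp
qed

text \<open>Orthonormal families in \<open>S\<close> have bounded length, so a longest one exists.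
  It spans \<open>S\<close>: for a vector outside its span, the normalised remainder after
  subtracting the projection would extend the family.\<close>

lemma orthonormal_basis_exists:
  assumes S: "subspace S"
  obtains m and f :: "nat \<Rightarrow> 'h" where "orthonormal {..<m} f" "f ` {..<m} \<subseteq> S" "span (f ` {..<m}) = S"
proof -
  obtain B where B: "finite B" "span B = UNIV" using finite_dim by blast
  let ?P = "\<lambda>m::nat. \<exists>f. orthonormal {..<m} f \<and> f ` {..<m} \<subseteq> S"
  have bound: "m \<le> card B" if "?P m" for m
  proof -
    from that obtain f where f: "orthonormal {..<m} f" by blast
    have "card {..<m} \<le> card B"
      by (rule independent_family_card_le[where f = f])
        (use B orthonormal_coeff_0[OF f] in auto)
    then show ?thesis by simp
  qed
  have "?P 0" by (auto simp: orthonormal_def)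
  then obtain m where m: "?P m" and max: "\<And>m'. ?P m' \<Longrightarrow> m' \<le> m"
    using ex_has_greatest_nat[of ?P 0 "\<lambda>x. x" "Suc (card B)"] bound le_imp_less_Suc by metis
  then obtain f where f: "orthonormal {..<m} f" "f ` {..<m} \<subseteq> S" by blast
  have "S \<subseteq> span (f ` {..<m})"
  proof (rule ccontr)
    assume "\<not> S \<subseteq> span (f ` {..<m})"
    then obtain v where v: "v \<in> S" "v \<notin> span (f ` {..<m})" by blast
    define w where "w = v - (\<Sum>i<m. scale (ip (f i) v) (f i))"
    have sum_span: "(\<Sum>i<m. scale (ip (f i) v) (f i)) \<in> span (f ` {..<m})"
      by (intro span_sum span_scale span_base) auto
    then have "w \<noteq> 0" using v unfolding w_def by auto
    then obtain c where c: "ip (scale c w) (scale c w) = 1" by (rule unit_multiple)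
    have "w \<in> S"
      using sum_span v(1) span_minimal[OF f(2) S] subspace_diff[OF S] unfolding w_def by blast
    have orth: "ip (f i) (scale c w) = 0" if "i < m" for i
      using orthonormal_sum[OF f(1), of i "\<lambda>i. ip (f i) v"] that
      by (simp add: w_def ip_scale_right ip_minus_right)
    then have orth': "ip (scale c w) (f i) = 0" if "i < m" for i
      using that by (subst ip_commute) simp
    have "orthonormal {..<Suc m} (f(m := scale c w))"
      using f(1) orth orth' c unfolding orthonormal_def
      by (auto simp: less_Suc_eq)
    moreover have "(f(m := scale c w)) ` {..<Suc m} \<subseteq> S"
      using f(2) subspace_scale[OF S \<open>w \<in> S\<close>] by (auto simp: less_Suc_eq)
    ultimately have "Suc m \<le> m" using max by blast
    then show False by simp
  qed
  then show ?thesis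
    using that[OF f] span_minimal[OF f(2) S] by blast
qed

section \<open>Linear operators, adjoints, orthogonal projections and eigenvectors\<close>

lemma operatorsI:
  assumes "\<And>x y. T (x + y) = T x + T y" "\<And>c x. T (scale c x) = scale c (T x)"
  shows "T \<in> operators"
  unfolding operators_def Vector_Spaces.linear_iff using assms vector_space_axioms by simp

lemma op_add: "T \<in> operators \<Longrightarrow> T (x + y) = T x + T y"
  and op_scaleR: "T \<in> operators \<Longrightarrow> T (scale c x) = scale c (T x)"
  unfolding operators_def Vector_Spaces.linear_iff by auto

lemma op_zero: "T \<in> operators \<Longrightarrow> T 0 = 0"
  using op_add[of T 0 0] by simp

lemma op_sum: "T \<in> operators \<Longrightarrow> T (sum g I) = (\<Sum>i\<in>I. T (g i))"
  by (induction I rule: infinite_finite_induct) (auto simp: op_zero op_add)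

lemma op_diff: "T \<in> operators \<Longrightarrow> T (x - y) = T x - T y"
  using op_add[of T "x - y" y] by (simp add: algebra_simps)

lemma adj_eqI:
  assumes "\<And>x y. ip (T x) y = ip x (S y)"
  shows "adj T = S"
  unfolding adj_def
proof (rule the_equality)
  show "\<forall>x y. ip (T x) y = ip x (S y)" using assms by blast
  fix S' assume "\<forall>x y. ip (T x) y = ip x (S' y)"
  then show "S' = S" using assms by (intro ext ip_eqI) metis
qed

text \<open>Supplies the witness for the definite description in \<open>adj\<close>: expanding
  \<open>x\<close> in an orthonormal basis shows that the explicit sum \<open>S\<close> satisfies
  the adjoint identity.\<close>

lemma ip_adj_right:
  assumes T: "T \<in> operators"
  shows "ip (T x) y = ip x (adj T y)"
proof -
  obtain m and f :: "nat \<Rightarrow> 'h" where f: "orthonormal {..<m} f" "span (f ` {..<m}) = UNIV"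
    using orthonormal_basis_exists[OF subspace_UNIV] by metis
  define S where "S y = (\<Sum>i<m. scale (ip (T (f i)) y) (f i))" for y
  have "ip (T x) y = ip x (S y)" for x y
  proof -
    have x: "x = (\<Sum>i<m. scale (ip (f i) x) (f i))"
      by (rule orthonormal_expand[OF f(1)]) (simp_all add: f(2))
    have "ip (T x) y = (\<Sum>i<m. cnj (ip (f i) x) * ip (T (f i)) y)"
      by (subst x) (simp add: op_sum[OF T] op_scaleR[OF T] ip_sum_left ip_scale_left)
    also have "\<dots> = ip x (S y)"
      by (simp add: S_def ip_sum_right ip_scale_right flip: ip_commute)
        (simp add: mult.commute)
    finally show ?thesis .
  qed
  then show ?thesis using adj_eqI by metis
qed

lemma ip_adj_left: "T \<in> operators \<Longrightarrow> ip (adj T x) y = ip x (T y)"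
  by (metis ip_adj_right ip_commute)

lemma adj_operator: "T \<in> operators \<Longrightarrow> adj T \<in> operators"
  by (intro operatorsI ip_eqI)
    (simp_all add: ip_add_right ip_scale_right op_add op_scaleR flip: ip_adj_right)

lemma adj_adj: "T \<in> operators \<Longrightarrow> adj (adj T) = T"
  by (intro adj_eqI ip_adj_left)

lemma adj_comp: "S \<in> operators \<Longrightarrow> T \<in> operators \<Longrightarrow> adj (S \<circ> T) = adj T \<circ> adj S"
  by (intro adj_eqI) (simp add: ip_adj_right)

lemma adj_plus: "S \<in> operators \<Longrightarrow> T \<in> operators \<Longrightarrow> adj (\<lambda>v. S v + T v) = (\<lambda>v. adj S v + adj T v)"
  by (intro adj_eqI) (simp add: ip_adj_right ip_add_left ip_add_right)

lemma adj_op_scale: "T \<in> operators \<Longrightarrow> adj (op_scale c T) = op_scale (cnj c) (adj T)"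
  unfolding op_scale_def
  by (intro adj_eqI) (simp add: ip_adj_right ip_scale_left ip_scale_right)

lemma op_comp: "S \<in> operators \<Longrightarrow> T \<in> operators \<Longrightarrow> S \<circ> T \<in> operators"
  by (intro operatorsI) (simp_all add: op_add op_scaleR)

text \<open>The projection expands \<open>v\<close> along an orthonormal basis of \<open>S\<close>.
  Invariance of \<open>S\<close> under \<open>x\<close> gives \<open>g x g = x g\<close>; invariance
  under \<open>adj x\<close> gives \<open>g x g = g x\<close> after taking adjoints.\<close>

lemma orthogonal_projection:
  assumes S: "subspace S"
  obtains g where "projection g" "range g = S" "\<And>v. v \<in> S \<Longrightarrow> g v = v"
    "\<And>x. x \<in> operators \<Longrightarrow> x ` S \<subseteq> S \<Longrightarrow> adj x ` S \<subseteq> S \<Longrightarrow> x \<circ> g = g \<circ> x"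
proof -
  obtain m and f :: "nat \<Rightarrow> 'h" where f: "orthonormal {..<m} f" "f ` {..<m} \<subseteq> S" "span (f ` {..<m}) = S"
    using orthonormal_basis_exists[OF S] by metis
  define g where "g v = (\<Sum>i<m. scale (ip (f i) v) (f i))" for v
  have gS: "g v \<in> S" for v
    unfolding g_def using f by (intro subspace_sum[OF S] subspace_scale[OF S]) auto
  have gfix: "g v = v" if "v \<in> S" for v
    unfolding g_def by (rule orthonormal_expand[OF f(1), symmetric]) (use f that in auto)
  have sa: "ip (g v) w = ip v (g w)" for v w
    by (simp add: g_def ip_sum_left ip_sum_right ip_scale_left ip_scale_right flip: ip_commute)
      (simp add: mult.commute)
  have "g \<in> operators"
    by (intro operatorsI) (simp_all add: g_def ip_add_right ip_scale_right scale_left_distrib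
        sum.distrib scale_sum_right)
  then have 1: "projection g"
    unfolding projection_def using adj_eqI[of g g, OF sa] gfix gS by auto
  have 2: "range g = S" using gS gfix by (metis image_subset_iff rangeI subset_antisym subsetI UNIV_I)
  have 3: "x \<circ> g = g \<circ> x" if x: "x \<in> operators" and inv: "x ` S \<subseteq> S" "adj x ` S \<subseteq> S" for x
  proof (intro ext ip_eqI)
    fix v w
    have "ip w ((x \<circ> g) v) = ip w (g (x (g v)))"
      using gfix[OF subsetD[OF inv(1) imageI[OF gS]]] by simp
    also have "\<dots> = ip (adj x (g w)) (g v)"
      by (simp only: ip_adj_left[OF x] sa)
    also have "\<dots> = ip (g (adj x (g w))) v" by (simp add: sa)
    also have "\<dots> = ip (adj x (g w)) v" using gfix[OF subsetD[OF inv(2) imageI[OF gS]]] by simp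
    also have "\<dots> = ip w ((g \<circ> x) v)" by (simp add: ip_adj_left[OF x] sa)
    finally show "ip w ((x \<circ> g) v) = ip w ((g \<circ> x) v)" .
  qed
  show ?thesis using that 1 2 gfix 3 by blast
qed

text \<open>\<open>T\<close> on \<open>S\<close> is represented by its matrix in an orthonormal
  basis. As \<open>S\<close> is nonzero, this complex matrix has positive size and hence an
  eigenvector, whose entries are the coefficients of \<open>w\<close>.\<close>

lemma eigenvector_exists:
  assumes S: "subspace S" "v0 \<in> S" "v0 \<noteq> 0" and T: "T \<in> operators" and inv: "T ` S \<subseteq> S"
  obtains w c where "w \<in> S" "w \<noteq> 0" "T w = scale c w"
proof -
  obtain m and f :: "nat \<Rightarrow> 'h" where f: "orthonormal {..<m} f" "f ` {..<m} \<subseteq> S" "span (f ` {..<m}) = S"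
    using orthonormal_basis_exists[OF S(1)] by metis
  have "m > 0" using f(3) S by (cases m) auto
  define A where "A = mat m m (\<lambda>(i, j). ip (f i) (T (f j)))"
  have A: "A \<in> carrier_mat m m" by (simp add: A_def)
  obtain c u where u: "u \<in> carrier_vec m" "u \<noteq> 0\<^sub>v m" "A *\<^sub>v u = c \<cdot>\<^sub>v u"
    using spectrum_non_empty[OF A \<open>m > 0\<close>] A
    by (auto simp: spectrum_def eigenvalue_def eigenvector_def)
  define w where "w = (\<Sum>j<m. scale (u $ j) (f j))"
  have "w \<in> S" unfolding w_def
    using f by (intro subspace_sum[OF S(1)] subspace_scale[OF S(1)]) auto
  moreover have "w \<noteq> 0"
  proof
    assume "w = 0"
    then have "u $ j = 0" if "j < m" for j
      using orthonormal_coeff_0[OF f(1), of "\<lambda>j. u $ j" j] that by (simp add: w_def)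
    with u show False by (auto simp: vec_eq_iff)
  qed
  moreover have "T w = scale c w"
  proof -
    have Tf: "T (f j) = (\<Sum>i<m. scale (A $$ (i, j)) (f i))" if "j < m" for j
    proof -
      have "T (f j) = (\<Sum>i<m. scale (ip (f i) (T (f j))) (f i))"
        by (rule orthonormal_expand[OF f(1)]) (use f inv that in auto)
      then show ?thesis using that by (simp add: A_def)
    qed
    have "T w = (\<Sum>j<m. \<Sum>i<m. scale (A $$ (i, j) * u $ j) (f i))"
      by (simp add: w_def op_sum[OF T] op_scaleR[OF T] Tf scale_sum_right mult.commute)
    also have "\<dots> = (\<Sum>i<m. scale (\<Sum>j<m. A $$ (i, j) * u $ j) (f i))"
      by (subst sum.swap) (simp add: scale_sum_left)
    also have "\<dots> = (\<Sum>i<m. scale ((A *\<^sub>v u) $ i) (f i))"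
      using A u(1) by (intro sum.cong) (auto simp: scalar_prod_def lessThan_atLeast0)
    also have "\<dots> = scale c w"
      using u by (simp add: w_def scale_sum_right u(3))
    finally show ?thesis .
  qed
  ultimately show ?thesis by (rule that)
qed

end

section \<open>Minimal projections and matrix units\<close>

text \<open>These axioms describe a finite-dimensional von Neumann algebra. Its matrix structure is
  obtained below directly from minimal projections.\<close>

locale star_algebra = finite_dim_hilbert_space scale ip
  for scale :: "complex \<Rightarrow> 'h::ab_group_add \<Rightarrow> 'h" and ip :: "'h \<Rightarrow> 'h \<Rightarrow> complex" +
  fixes M :: "('h \<Rightarrow> 'h) set"
  assumes M_op: "x \<in> M \<Longrightarrow> x \<in> operators"
    and M_id: "id \<in> M"
    and M_plus: "x \<in> M \<Longrightarrow> y \<in> M \<Longrightarrow> (\<lambda>v. x v + y v) \<in> M"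
    and M_scale: "x \<in> M \<Longrightarrow> op_scale c x \<in> M"
    and M_comp: "x \<in> M \<Longrightarrow> y \<in> M \<Longrightarrow> x \<circ> y \<in> M"
    and M_adj: "x \<in> M \<Longrightarrow> adj x \<in> M"
begin

lemma M_zero: "(\<lambda>v. 0) \<in> M"
  using M_scale[OF M_id, of 0] by (simp add: op_scale_def)

lemma M_sum: "(\<And>i. i \<in> I \<Longrightarrow> x i \<in> M) \<Longrightarrow> (\<lambda>v. \<Sum>i\<in>I. x i v) \<in> M"
  by (induction I rule: infinite_finite_induct) (auto intro: M_zero M_plus)

lemmas M_add = op_add[OF M_op] and M_scaleR = op_scaleR[OF M_op] and M_0 = op_zero[OF M_op]

text \<open>A self-adjoint nonzero element \<open>h\<close> of \<open>eM\<close> with largest possible kernel satisfies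
  \<open>hyh = \<lambda>h\<close>: an eigenvector of \<open>hy\<close> in the range of \<open>h\<close> would otherwise enlarge the kernel
  of \<open>hyh - \<lambda>h\<close>.\<close>

lemma minimal_projection_exists:
  assumes e: "e \<in> M" "e \<noteq> (\<lambda>v. 0)" "e \<circ> e = e" "\<And>x. x \<in> M \<Longrightarrow> e \<circ> x = x \<circ> e"
  obtains p where "p \<in> M" "p \<noteq> (\<lambda>v. 0)" "projection p" "e \<circ> p = p" "p \<circ> e = p"
    "\<And>y. y \<in> M \<Longrightarrow> \<exists>c. \<forall>v. p (y (p v)) = scale c (p v)"
proof -
  obtain B0 where "finite B0" "span B0 = UNIV" using finite_dim by blast
  then obtain B where B: "finite B" "independent B" "span B = UNIV"
    using maximal_independent_subset[of B0] by (metis finite_subset span_mono span_span top.extremum_uniqueI)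
  interpret fd: finite_dimensional_vector_space scale B
    by unfold_locales (use B in auto)
  define ker where "ker x = {v. x v = (0::'h)}" for x :: "'h \<Rightarrow> 'h"
  have ker_sub: "subspace (ker x)" if "x \<in> M" for x
    unfolding subspace_def ker_def using that by (auto simp: M_add M_scaleR M_0)
  have ker_mono: "dim (ker x) < dim (ker y)" if "x \<in> M" "y \<in> M" "ker x \<subset> ker y" for x y
    using fd.dim_psubset ker_sub that span_eq_iff by metis
  let ?P = "\<lambda>d. \<exists>x\<in>M. x \<noteq> (\<lambda>v. 0) \<and> e \<circ> x = x \<and> dim (ker x) = d"
  have "?P (dim (ker e))" using e by blast
  moreover have "\<forall>d. ?P d \<longrightarrow> d < Suc (card B)"
    using fd.dim_subset_UNIV by (auto simp: fd.dimension_def less_Suc_eq_le)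
  ultimately obtain x where x: "x \<in> M" "x \<noteq> (\<lambda>v. 0)" "e \<circ> x = x"
    and max: "\<And>y. y \<in> M \<Longrightarrow> y \<noteq> (\<lambda>v. 0) \<Longrightarrow> e \<circ> y = y \<Longrightarrow> dim (ker y) \<le> dim (ker x)"
    using ex_has_greatest_nat[of ?P _ "\<lambda>d. d" "Suc (card B)"] by metis
  \<comment> \<open>\<open>adj x \<circ> x\<close> is self-adjoint and has the same kernel as
    \<open>x\<close>, so it inherits the maximality of the kernel.\<close>
  define h where "h = adj x \<circ> x"
  have hM: "h \<in> M" using x by (simp add: h_def M_comp M_adj)
  note h_op = M_op[OF hM]
  have h_sa: "adj h = h"
    using x by (simp add: h_def adj_comp adj_adj M_op adj_operator)
  have ip_h: "ip v (h w) = ip (x v) (x w)" for v w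
    using x by (simp add: h_def ip_adj_right M_op)
  have ker_h: "ker h = ker x"
  proof -
    have "x v = 0" if "h v = 0" for v using ip_h[of v v] that by simp
    moreover have "h v = 0" if "x v = 0" for v
      using that x by (simp add: h_def M_0 M_adj)
    ultimately show ?thesis by (auto simp: ker_def)
  qed
  have eh: "e \<circ> h = h"
  proof -
    have "e \<circ> h = adj x \<circ> e \<circ> x"
      using e(4)[OF M_adj[OF x(1)]] by (simp add: h_def o_assoc)
    then show ?thesis using x(3) by (simp add: h_def comp_assoc)
  qed
  obtain v0 where v0: "x v0 \<noteq> 0" using x(2) by auto
  have hv0: "h v0 \<noteq> 0" using v0 ker_h by (auto simp: ker_def)
  have hyh: "\<exists>c. \<forall>v. h (y (h v)) = scale c (h v)" if y: "y \<in> M" for y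
  proof -
    have "subspace (range h)"
      unfolding subspace_def
      by (metis (no_types, lifting) op_zero[OF h_op] op_add[OF h_op] op_scaleR[OF h_op] rangeE rangeI)
    moreover have "(h \<circ> y) ` range h \<subseteq> range h" by auto
    ultimately obtain w c where w: "w \<in> range h" "w \<noteq> 0" "(h \<circ> y) w = scale c w"
      using eigenvector_exists[of "range h" "h v0" "h \<circ> y"] hv0 M_op[OF M_comp[OF hM y]]
      by (metis rangeI)
    then obtain v where v: "w = h v" by blast
    define z where "z = (\<lambda>v. (h \<circ> y \<circ> h) v + op_scale (- c) h v)"
    have z: "z \<in> M" unfolding z_def by (intro M_plus M_comp M_scale hM y)
    have zv: "z u = h (y (h u)) - scale c (h u)" for u
      by (simp add: z_def op_scale_def)
    have "e \<circ> z = z"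
    proof
      fix u
      have "e (h u') = h u'" for u' using eh by (metis comp_apply)
      then show "(e \<circ> z) u = z u"
        using e(1) by (simp add: zv op_diff[OF M_op] M_scaleR)
    qed
    moreover have "ker h \<subset> ker z"
    proof
      show "ker h \<subseteq> ker z" using y by (auto simp: ker_def zv M_0 hM)
      have "v \<in> ker z" "v \<notin> ker h" using w v by (auto simp: ker_def zv)
      then show "ker h \<noteq> ker z" by blast
    qed
    ultimately have "z = (\<lambda>v. 0)"
      using max[OF z] ker_mono[OF hM z] ker_h by fastforce
    then show ?thesis by (metis zv eq_iff_diff_eq_0)
  qed
  \<comment> \<open>The case \<open>y = id\<close> gives \<open>h \<circ> h = l h\<close>. Testing
    it on \<open>v0\<close> shows that \<open>l\<close> is the positive real \<open>r\<close>, so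
    \<open>h / r\<close> is a projection.\<close>
  obtain l where l: "\<And>v. h (h v) = scale l (h v)" using hyh[OF M_id] by auto
  define r where "r = Re (ip (h v0) (h v0)) / Re (ip (x v0) (x v0))"
  have xp: "Re (ip (x v0) (x v0)) > 0" and hp: "Re (ip (h v0) (h v0)) > 0"
    using ip_pos v0 hv0 by auto
  have "ip (h v0) (h v0) = ip v0 (h (h v0))"
    using ip_adj_right[OF h_op, of v0 "h v0"] by (simp add: h_sa)
  also have "\<dots> = l * ip (x v0) (x v0)"
    by (simp add: l ip_scale_right ip_h)
  finally have "complex_of_real (Re (ip (h v0) (h v0))) = l * complex_of_real (Re (ip (x v0) (x v0)))"
    unfolding ip_self_real[of "h v0", symmetric] ip_self_real[of "x v0", symmetric] .
  then have l_r: "l = complex_of_real r" and r: "r > 0"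
    using xp hp by (auto simp: r_def field_simps)
  define p where "p = op_scale (complex_of_real (1 / r)) h"
  have p_apply: "p v = scale (complex_of_real (1 / r)) (h v)" for v by (simp add: p_def op_scale_def)
  have pM: "p \<in> M" unfolding p_def by (intro M_scale hM)
  have hs: "h (scale c v) = scale c (h v)" for c v by (rule op_scaleR[OF h_op])
  show ?thesis
  proof (rule that[OF pM])
    show "p \<noteq> (\<lambda>v. 0)" using hv0 r by (auto simp: fun_eq_iff p_apply)
    show "projection p"
      unfolding projection_def
    proof (intro conjI)
      show "p \<circ> p = p" using r by (auto simp: fun_eq_iff p_apply hs l l_r)
      show "adj p = p" by (simp add: p_def adj_op_scale h_op h_sa)
    qed (rule M_op[OF pM])
    show ep: "e \<circ> p = p"
      using eh e(1) by (auto simp: fun_eq_iff p_apply M_scaleR)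
    show "p \<circ> e = p" using e(4)[OF pM] ep by simp
    fix y assume y: "y \<in> M"
    then obtain c where "\<And>v. h (y (h v)) = scale c (h v)" using hyh by blast
    then have "p (y (p v)) = scale (c / complex_of_real r) (p v)" for v
      using y by (simp add: p_apply hs M_scaleR mult.commute)
    then show "\<exists>c. \<forall>v. p (y (p v)) = scale c (p v)" by blast
  qed
qed

text \<open>The last property makes the \<open>u\<^sub>i u\<^sub>j*\<close> matrix units on \<open>M\<zeta>\<close>.\<close>

lemma matrix_units_exist:
  assumes p: "p \<in> M" "projection p" "\<And>y. y \<in> M \<Longrightarrow> \<exists>c. \<forall>v. p (y (p v)) = scale c (p v)"
    and \<zeta>: "p \<zeta> = \<zeta>" "ip \<zeta> \<zeta> = 1"
  obtains m and u :: "nat \<Rightarrow> 'h \<Rightarrow> 'h" where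
    "\<And>i. i < m \<Longrightarrow> u i \<in> M" "\<And>i. i < m \<Longrightarrow> u i \<circ> p = u i"
    "orthonormal {..<m} (\<lambda>i. u i \<zeta>)"
    "\<And>x. x \<in> M \<Longrightarrow> x \<zeta> = (\<Sum>i<m. scale (ip (u i \<zeta>) (x \<zeta>)) (u i \<zeta>))"
    "\<And>i j. i < m \<Longrightarrow> j < m \<Longrightarrow> adj (u i) (u j \<zeta>) = (if i = j then \<zeta> else 0)"
proof -
  let ?L = "(\<lambda>x. x \<zeta>) ` M"
  have L: "subspace ?L"
    unfolding subspace_def
  proof (intro conjI ballI allI)
    show "0 \<in> ?L" using M_zero by (force intro: image_eqI[of _ _ "\<lambda>v. 0"])
    fix a b assume "a \<in> ?L" "b \<in> ?L"
    then show "a + b \<in> ?L" using M_plus by force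
  next
    fix c a assume "a \<in> ?L"
    then obtain x where x: "a = x \<zeta>" "x \<in> M" by blast
    then show "scale c a \<in> ?L"
      using M_scale[of x c] by (intro image_eqI[of _ _ "op_scale c x"]) (auto simp: op_scale_def)
  qed
  obtain m and b :: "nat \<Rightarrow> 'h" where b: "orthonormal {..<m} b" "b ` {..<m} \<subseteq> ?L" "span (b ` {..<m}) = ?L"
    using orthonormal_basis_exists[OF L] by metis
  have "\<forall>i\<in>{..<m}. \<exists>x\<in>M. b i = x \<zeta>" using b(2) by blast
  then obtain x where x: "\<And>i. i < m \<Longrightarrow> x i \<in> M" "\<And>i. i < m \<Longrightarrow> b i = x i \<zeta>"
    by (metis lessThan_iff)
  \<comment> \<open>Right multiplication by \<open>p\<close> keeps the value at
    \<open>\<zeta>\<close> and turns \<open>adj (u i) \<circ> u j\<close> into an element of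
    \<open>p M p\<close>, hence a scalar multiple of \<open>p\<close>; orthonormality then fixes the
    scalar.\<close>
  define u where "u i = x i \<circ> p" for i
  have u\<zeta>: "u i \<zeta> = b i" if "i < m" for i using that x \<zeta> by (simp add: u_def)
  have uM: "u i \<in> M" if "i < m" for i using that x p by (simp add: u_def M_comp)
  have on: "orthonormal {..<m} (\<lambda>i. u i \<zeta>)"
    using b(1) u\<zeta> by (simp add: orthonormal_def)
  have pp: "p \<circ> p = p" "adj p = p" using p(2) by (auto simp: projection_def)
  show ?thesis
  proof (rule that[of m u])
    show "u i \<circ> p = u i" if "i < m" for i by (simp add: u_def comp_assoc pp)
    show "y \<zeta> = (\<Sum>i<m. scale (ip (u i \<zeta>) (y \<zeta>)) (u i \<zeta>))" if "y \<in> M" for y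
    proof (rule orthonormal_expand[OF on])
      have "(\<lambda>i. u i \<zeta>) ` {..<m} = b ` {..<m}" using u\<zeta> by auto
      then show "y \<zeta> \<in> span ((\<lambda>i. u i \<zeta>) ` {..<m})" using b(3) that by auto
    qed simp
    show "adj (u i) (u j \<zeta>) = (if i = j then \<zeta> else 0)" if ij: "i < m" "j < m" for i j
    proof -
      obtain c where c: "\<And>v. p ((adj (x i) \<circ> x j) (p v)) = scale c (p v)"
        using p(3)[OF M_comp[OF M_adj[OF x(1)[OF ij(1)]] x(1)[OF ij(2)]]] by blast
      have "adj (u i) (u j \<zeta>) = scale c \<zeta>"
        using c[of \<zeta>] ij x p by (simp add: u_def adj_comp M_op pp \<zeta>)
      moreover have "ip \<zeta> (adj (u i) (u j \<zeta>)) = (if i = j then 1 else 0)"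
        using on ij by (auto simp: orthonormal_def simp flip: ip_adj_right[OF M_op[OF uM]])
      ultimately show ?thesis by (auto simp: ip_scale_right \<zeta>)
    qed
  qed (use uM on in auto)
qed

end

section \<open>Irreducible solutions with two central projections\<close>

text \<open>\<open>comm\<close> is stated with \<open>J y J\<close> instead of
  \<open>J (adj y) J\<close>; both run through the same operators since \<open>M\<close> is closed
  under adjoints. \<open>sep\<close> says that evaluation at some vector is injective on
  \<open>M\<close>. The conditions are symmetric in \<open>e\<close> and \<open>f\<close>.\<close>

locale split_solution = star_algebra scale ip M
  for scale :: "complex \<Rightarrow> 'h::ab_group_add \<Rightarrow> 'h" and ip :: "'h \<Rightarrow> 'h \<Rightarrow> complex" and M +
  fixes J e f :: "'h \<Rightarrow> 'h"
  assumes antiunitary_J: "antiunitary J"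
    and JJ: "J (J v) = v"
    and comm: "x \<in> M \<Longrightarrow> y \<in> M \<Longrightarrow> x (J (y (J v))) = J (y (J (x v)))"
    and irr: "projection g \<Longrightarrow> (\<And>x v. x \<in> M \<Longrightarrow> g (x v) = x (g v)) \<Longrightarrow> (\<And>v. g (J v) = J (g v))
      \<Longrightarrow> g = (\<lambda>v. 0) \<or> g = id"
    and sep: "\<exists>\<xi>. \<forall>x\<in>M. x \<xi> = 0 \<longrightarrow> x = (\<lambda>v. 0)"
    and eM: "e \<in> M" and fM: "f \<in> M"
    and ee: "e (e v) = e v" and ff: "f (f v) = f v"
    and ef: "e (f v) = 0" and fe: "f (e v) = 0"
    and ef_sum: "e v + f v = v"
    and e_adj: "adj e = e" and f_adj: "adj f = f"
    and e_central: "x \<in> M \<Longrightarrow> e (x v) = x (e v)" and f_central: "x \<in> M \<Longrightarrow> f (x v) = x (f v)"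
    and e_nz: "e \<noteq> (\<lambda>v. 0)" and f_nz: "f \<noteq> (\<lambda>v. 0)"
begin

lemma swap: "split_solution scale ip M J f e"
proof -
  have fe_sum: "f v + e v = v" for v
    using ef_sum[of v] by (simp add: add.commute)
  show ?thesis
    by unfold_locales
      (fact antiunitary_J JJ comm irr sep eM fM ee ff ef fe fe_sum e_adj f_adj e_central f_central e_nz f_nz)+
qed

section \<open>Conjugation by the antiunitary involution \<open>J\<close>\<close>

lemma J_add: "J (x + y) = J x + J y"
  and J_scale: "J (scale c x) = scale (cnj c) (J x)"
  and J_ip: "ip (J x) (J y) = ip y x"
  using antiunitary_J unfolding antiunitary_def by auto

lemma J_0: "J 0 = 0"
  using J_add[of 0 0] by simp

lemma J_sum: "J (sum g I) = (\<Sum>i\<in>I. J (g i))"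
  by (induction I rule: infinite_finite_induct) (auto simp: J_0 J_add)

lemma J_eq_0_iff: "J v = 0 \<longleftrightarrow> v = 0"
  by (metis J_0 JJ)

lemma conj_operator: "x \<in> operators \<Longrightarrow> (\<lambda>v. J (x (J v))) \<in> operators"
  by (rule operatorsI) (simp_all add: J_add J_scale op_add op_scaleR)

lemma ip_J: "ip (J v) w = ip (J w) v"
  using J_ip[of v "J w"] by (simp add: JJ)

lemma ip_conj: "x \<in> operators \<Longrightarrow> ip (J (x (J v))) w = ip v (J (adj x (J w)))"
  using ip_J[of "x (J v)" w] ip_adj_left[of x "J w" "J v"] J_ip[of "J (adj x (J w))" v]
  by (simp add: JJ)

lemma adj_conj: "x \<in> operators \<Longrightarrow> adj (\<lambda>v. J (x (J v))) = (\<lambda>v. J (adj x (J v)))"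
  by (intro adj_eqI ip_conj)

text \<open>Irreducibility leaves only 0 and the identity for the product of the commuting
  projections \<open>e\<close> and \<open>J e J\<close>. The identity is impossible, because
  \<open>f\<close> annihilates the range of \<open>e\<close> and is nonzero.\<close>

lemma e_conj_e: "e (J (e (J v))) = 0"
proof -
  define g where "g v = e (J (e (J v)))" for v
  have gg: "g (g v) = g v" for v
  proof -
    have "J (e (J (e (J (e (J v)))))) = e (J (e (J v)))"
      using comm[OF eM eM, of "J (e (J v))"] by (simp add: JJ ee)
    then show ?thesis by (simp add: g_def ee)
  qed
  have "ip (g v) w = ip v (g w)" for v w
    unfolding g_def
    using ip_adj_right[OF M_op[OF eM], of "J (e (J v))" w] ip_conj[OF M_op[OF eM], of v "e w"]
      comm[OF eM eM] by (simp add: e_adj)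
  moreover have "g \<in> operators"
    unfolding g_def using op_comp[OF M_op[OF eM] conj_operator[OF M_op[OF eM]]] by (simp add: comp_def)
  ultimately have "projection g"
    unfolding projection_def using gg adj_eqI[of g g] by auto
  moreover have "g (x v) = x (g v)" if "x \<in> M" for x v
    unfolding g_def using comm[OF that eM, of v] e_central[OF that, of "J (e (J v))"] by simp
  moreover have "g (J v) = J (g v)" for v
    unfolding g_def using comm[OF eM eM, of "J v"] by (simp add: JJ)
  ultimately have "g = (\<lambda>v. 0) \<or> g = id"
    by (rule irr)
  moreover have "g \<noteq> id"
  proof
    assume "g = id"
    then have "f v = f (e (J (e (J v))))" for v by (metis g_def id_apply)
    then show False using f_nz by (simp add: fe fun_eq_iff)
  qed
  ultimately show ?thesis by (metis g_def)
qed

text \<open>\<open>e J e J = 0\<close> places the range of \<open>J e J\<close> inside that of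
  \<open>f\<close>. The same statement for \<open>f\<close>, with \<open>J e J + J f J = 1\<close>,
  gives \<open>f = f J e J\<close>. Hence \<open>J e J = f\<close>.\<close>

lemma J_e: "J (e v) = f (J v)"
proof -
  have ff0: "f (J (f (J v))) = 0" for v by (rule split_solution.e_conj_e[OF swap])
  have "J (e (J v)) = f v" for v
  proof -
    have "f v = f (J (e (J v) + f (J v)))" by (simp add: ef_sum JJ)
    also have "\<dots> = f (J (e (J v)))" by (simp add: J_add M_add fM ff0)
    also have "\<dots> = J (e (J v))"
      using ef_sum[of "J (e (J v))"] e_conj_e by simp
    finally show ?thesis by simp
  qed
  from this[of "J v"] show ?thesis by (simp add: JJ)
qed

lemma J_f: "J (f v) = e (J v)"
  by (rule split_solution.J_e[OF swap])

text \<open>The range of \<open>g\<close> lies under \<open>e\<close> and that of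
  \<open>J g J\<close> under \<open>f\<close>, so they are orthogonal and
  \<open>k = g + J g J\<close> is a projection. Irreducibility and \<open>k v0 = v0\<close> make
  \<open>k\<close> the identity; on the range of \<open>e\<close> the summand \<open>J g J\<close>
  vanishes, leaving \<open>g (e v) = e v\<close>.\<close>

lemma invariant_subspace:
  assumes S: "subspace S" and v0: "v0 \<in> S" "v0 \<noteq> 0" and Se: "\<And>v. v \<in> S \<Longrightarrow> e v = v"
    and inv: "\<And>x v. x \<in> M \<Longrightarrow> v \<in> S \<Longrightarrow> x v \<in> S"
    and inv': "\<And>x v. x \<in> M \<Longrightarrow> v \<in> S \<Longrightarrow> J (x (J v)) \<in> S"
  shows "e v \<in> S"
proof -
  obtain g where g: "projection g" "range g = S" and gS: "\<And>v. v \<in> S \<Longrightarrow> g v = v"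
    and g_comm: "\<And>x. x \<in> operators \<Longrightarrow> x ` S \<subseteq> S \<Longrightarrow> adj x ` S \<subseteq> S \<Longrightarrow> x \<circ> g = g \<circ> x"
    using orthogonal_projection[OF S] by metis
  have g_op: "g \<in> operators" and g_adj: "adj g = g" using g(1) by (auto simp: projection_def)
  have gg: "g (g v) = g v" for v using g(2) gS by blast
  have gx: "g (x v) = x (g v)" if "x \<in> M" for x v
    using g_comm[of x] that inv M_op M_adj by (auto simp: fun_eq_iff image_subset_iff)
  have gJ: "g (J (x (J v))) = J (x (J (g v)))" if "x \<in> M" for x v
    using g_comm[OF conj_operator[OF M_op[OF that]]] that inv' M_adj[OF that]
    by (auto simp: fun_eq_iff image_subset_iff adj_conj M_op)
  have eg: "e (g v) = g v" for v using g(2) Se by blast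
  have gf: "g (f v) = 0" for v
    using gx[OF fM, of v] fe[of "g v"] by (simp add: eg)
  have gJg: "g (J (g v)) = 0" for v
    using J_e[of "g v"] gf[of "J (g v)"] by (simp add: eg)
  define k where "k v = g v + J (g (J v))" for v
  have kk: "k (k v) = k v" for v
    by (simp add: k_def op_add[OF g_op] J_add gg gJg J_0 JJ)
  have k_op: "k \<in> operators"
    by (rule operatorsI) (simp_all add: k_def op_add[OF g_op] op_scaleR[OF g_op] J_add J_scale scale_right_distrib)
  have "ip (k v) w = ip v (k w)" for v w
    using ip_adj_right[OF g_op] ip_conj[OF g_op]
    by (simp add: k_def ip_add_left ip_add_right g_adj)
  then have "projection k"
    unfolding projection_def using kk k_op adj_eqI[of k k] by auto
  moreover have "k (x v) = x (k v)" if "x \<in> M" for x v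
  proof -
    have "J (g (J (x v))) = x (J (g (J v)))"
      using gJ[OF that, of "J v"] by (simp add: JJ)
    then show ?thesis using that by (simp add: k_def gx M_add)
  qed
  moreover have "k (J v) = J (k v)" for v
    by (simp add: k_def J_add JJ add.commute)
  ultimately have "k = (\<lambda>v. 0) \<or> k = id"
    by (rule irr)
  moreover have "k v0 = v0"
    using gS[OF v0(1)] gJg[of v0] by (simp add: k_def J_0)
  ultimately have "k (e v) = e v" using v0(2) by auto
  moreover have "k (e v) = g (e v)" by (simp add: k_def J_e gf J_0)
  ultimately show ?thesis using g(2) by (metis rangeI)
qed

text \<open>One vector has to serve both halves: \<open>\<xi>\<close> generates a cyclic space of
  \<open>M\<close> under \<open>e\<close>, and \<open>J \<xi>\<close> one under \<open>f\<close>. It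
  is taken from the range of \<open>p J q J\<close>, once this product is known not to
  vanish.\<close>

lemma joint_minimal_vector:
  obtains p q \<xi> where
    "p \<in> M" "projection p" "\<And>y. y \<in> M \<Longrightarrow> \<exists>c. \<forall>v. p (y (p v)) = scale c (p v)" "p \<circ> e = p"
    "q \<in> M" "projection q" "\<And>y. y \<in> M \<Longrightarrow> \<exists>c. \<forall>v. q (y (q v)) = scale c (q v)" "q \<circ> f = q"
    "p \<xi> = \<xi>" "q (J \<xi>) = J \<xi>" "ip \<xi> \<xi> = 1" "e \<xi> = \<xi>"
proof -
  have comp: "e \<circ> e = e" "f \<circ> f = f" by (simp_all add: fun_eq_iff ee ff)
  have central: "e \<circ> x = x \<circ> e" "f \<circ> x = x \<circ> f" if "x \<in> M" for x
    using e_central[OF that] f_central[OF that] by (simp_all add: fun_eq_iff)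
  obtain p where p: "p \<in> M" "p \<noteq> (\<lambda>v. 0)" "projection p" "e \<circ> p = p" "p \<circ> e = p"
    "\<And>y. y \<in> M \<Longrightarrow> \<exists>c. \<forall>v. p (y (p v)) = scale c (p v)"
    using minimal_projection_exists[OF eM e_nz comp(1) central(1)] by metis
  obtain q where q: "q \<in> M" "q \<noteq> (\<lambda>v. 0)" "projection q" "f \<circ> q = q" "q \<circ> f = q"
    "\<And>y. y \<in> M \<Longrightarrow> \<exists>c. \<forall>v. q (y (q v)) = scale c (q v)"
    using minimal_projection_exists[OF fM f_nz comp(2) central(2)] by metis
  have qf: "q (f v) = q v" for v using fun_cong[OF q(5)] by simp
  have pp: "p (p v) = p v" "q (q v) = q v" for v
    using p(3) q(3) unfolding projection_def by (simp_all add: fun_eq_iff)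
  have ep: "e (p v) = p v" for v using fun_cong[OF p(4)] by simp
  have "\<exists>v. p (J (q (J v))) \<noteq> 0"
  proof (rule ccontr)
    assume "\<nexists>v. p (J (q (J v))) \<noteq> 0"
    then have pq: "J (q (J (p v))) = 0" for v using comm[OF p(1) q(1), of v] by simp
    \<comment> \<open>If \<open>p J q J = 0\<close>, then \<open>S\<close> contains
      \<open>p v1 \<noteq> 0\<close>. Being invariant under \<open>M\<close> and
      \<open>J M J\<close>, it is the whole range of \<open>e\<close>, so
      \<open>q J e = q f J = q J\<close> vanishes, contradicting
      \<open>q \<noteq> 0\<close>.\<close>
    define S where "S = {v. e v = v \<and> (\<forall>y\<in>M. q (y (J v)) = 0)}"
    obtain v1 where v1: "p v1 \<noteq> 0" using p(2) by auto
    have J_conj: "y (J (x v)) = J (x (J (y (J v))))" if "x \<in> M" "y \<in> M" for x y v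
      by (simp add: comm[OF that] JJ)
    have "subspace S"
      unfolding subspace_def S_def
      by (auto simp: J_add J_scale J_0 M_add M_scaleR M_0 eM q(1))
    moreover have "p v1 \<in> S"
    proof -
      have "q (y (J (p v1))) = 0" if "y \<in> M" for y
        using J_conj[OF p(1) that, of v1] pq[of "J (y (J v1))"] by (simp add: J_eq_0_iff)
      then show ?thesis unfolding S_def by (simp add: ep)
    qed
    moreover have "x v \<in> S" if x: "x \<in> M" and v: "v \<in> S" for x v
    proof -
      have "q (y (J (x v))) = 0" if y: "y \<in> M" for y
      proof -
        have "q (y (J v)) = 0" using v y unfolding S_def by blast
        then show ?thesis
          using J_conj[OF x M_comp[OF q(1) y], of v]
          by (simp add: J_0 M_0[OF x])
      qed
      then show ?thesis using v unfolding S_def by (simp add: e_central[OF x])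
    qed
    moreover have "J (x (J v)) \<in> S" if x: "x \<in> M" and v: "v \<in> S" for x v
    proof -
      have "q (y (x (J v))) = 0" if "y \<in> M" for y
        using v M_comp[OF that x] unfolding S_def by auto
      moreover have "e (J (x (J v))) = J (x (J (e v)))"
        using f_central[OF x, of "J v"] J_f[of "x (J v)"] by (simp add: J_e)
      ultimately show ?thesis using v unfolding S_def by (simp add: JJ)
    qed
    ultimately have "e v \<in> S" for v
      using v1 by (intro invariant_subspace[of S "p v1"]) (auto simp: S_def)
    then have "q (J (e v)) = 0" for v
      unfolding S_def using M_id by force
    then have "q (J v) = 0" for v by (simp add: J_e qf)
    then have "q v = 0" for v by (metis JJ)
    with q(2) show False by auto
  qed
  then obtain v where v: "p (J (q (J v))) \<noteq> 0" by blast
  obtain c where c: "ip (scale c (p (J (q (J v))))) (scale c (p (J (q (J v))))) = 1"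
    using unit_multiple[OF v] by blast
  define \<xi> where "\<xi> = scale c (p (J (q (J v))))"
  have p\<xi>: "p \<xi> = \<xi>" by (simp add: \<xi>_def M_scaleR[OF p(1)] pp)
  \<comment> \<open>\<open>p\<close> and \<open>J q J\<close> commute, so \<open>J q J\<close> also
    fixes vectors in the range of the product.\<close>
  have q\<xi>: "q (J \<xi>) = J \<xi>"
    by (simp add: \<xi>_def comm[OF p(1) q(1)] J_scale M_scaleR[OF q(1)] pp JJ)
  have unit: "ip \<xi> \<xi> = 1" using c by (simp only: \<xi>_def)
  have e\<xi>: "e \<xi> = \<xi>" using ep[of \<xi>] by (simp only: p\<xi>)
  show ?thesis
    by (rule that[of p q \<xi>]) (fact p q p\<xi> q\<xi> unit e\<xi>)+
qed

end

text \<open>Condenses \<open>p\<close> and \<open>q\<close> into relations on \<open>\<xi>\<close>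
  and \<open>J \<xi>\<close>. \<open>u_e\<close> and \<open>w_f\<close>, inherited from
  \<open>p e = p\<close> and \<open>q f = q\<close>, localise the two frames at \<open>e\<close> and
  \<open>f\<close>.\<close>

locale framed_solution = split_solution scale ip M J e f
  for scale :: "complex \<Rightarrow> 'h::ab_group_add \<Rightarrow> 'h" and ip :: "'h \<Rightarrow> 'h \<Rightarrow> complex" and M J e f +
  fixes \<xi> :: 'h and k l :: nat and u w :: "nat \<Rightarrow> 'h \<Rightarrow> 'h"
  assumes \<xi>_unit: "ip \<xi> \<xi> = 1" and \<xi>_e: "e \<xi> = \<xi>"
    and u_M: "i < k \<Longrightarrow> u i \<in> M" and u_e: "i < k \<Longrightarrow> u i (e v) = u i v"
    and u_on: "orthonormal {..<k} (\<lambda>i. u i \<xi>)"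
    and u_exp: "x \<in> M \<Longrightarrow> x \<xi> = (\<Sum>i<k. scale (ip (u i \<xi>) (x \<xi>)) (u i \<xi>))"
    and u_adj: "i < k \<Longrightarrow> j < k \<Longrightarrow> adj (u i) (u j \<xi>) = (if i = j then \<xi> else 0)"
    and w_M: "i < l \<Longrightarrow> w i \<in> M" and w_f: "i < l \<Longrightarrow> w i (f v) = w i v"
    and w_on: "orthonormal {..<l} (\<lambda>i. w i (J \<xi>))"
    and w_exp: "x \<in> M \<Longrightarrow> x (J \<xi>) = (\<Sum>i<l. scale (ip (w i (J \<xi>)) (x (J \<xi>))) (w i (J \<xi>)))"
    and w_adj: "i < l \<Longrightarrow> j < l \<Longrightarrow> adj (w i) (w j (J \<xi>)) = (if i = j then J \<xi> else 0)"

context split_solution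
begin

lemma frame_exists: "\<exists>\<xi> k l u w. framed_solution scale ip M J e f \<xi> k l u w"
proof -
  obtain p q \<xi> where
    p: "p \<in> M" "projection p" "\<And>y. y \<in> M \<Longrightarrow> \<exists>c. \<forall>v. p (y (p v)) = scale c (p v)" "p \<circ> e = p"
    and q: "q \<in> M" "projection q" "\<And>y. y \<in> M \<Longrightarrow> \<exists>c. \<forall>v. q (y (q v)) = scale c (q v)" "q \<circ> f = q"
    and \<xi>: "p \<xi> = \<xi>" "q (J \<xi>) = J \<xi>" "ip \<xi> \<xi> = 1" "e \<xi> = \<xi>"
    by (rule joint_minimal_vector, rule that)
  obtain k :: nat and u :: "nat \<Rightarrow> 'h \<Rightarrow> 'h" where u:
    "\<And>i. i < k \<Longrightarrow> u i \<in> M" "\<And>i. i < k \<Longrightarrow> u i \<circ> p = u i"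
    "orthonormal {..<k} (\<lambda>i. u i \<xi>)"
    "\<And>x. x \<in> M \<Longrightarrow> x \<xi> = (\<Sum>i<k. scale (ip (u i \<xi>) (x \<xi>)) (u i \<xi>))"
    "\<And>i j. i < k \<Longrightarrow> j < k \<Longrightarrow> adj (u i) (u j \<xi>) = (if i = j then \<xi> else 0)"
  proof (rule matrix_units_exist[OF p(1,2) _ \<xi>(1,3)], goal_cases)
    case (1 y)
    show ?case by (rule p(3)) (fact 1)
  next
    case (2 k u)
    show ?thesis by (rule 2(1)[of k u]) (fact 2)+
  qed
  have J\<xi>: "ip (J \<xi>) (J \<xi>) = 1" by (simp add: J_ip \<xi>)
  obtain l :: nat and w :: "nat \<Rightarrow> 'h \<Rightarrow> 'h" where w:
    "\<And>i. i < l \<Longrightarrow> w i \<in> M" "\<And>i. i < l \<Longrightarrow> w i \<circ> q = w i"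
    "orthonormal {..<l} (\<lambda>i. w i (J \<xi>))"
    "\<And>x. x \<in> M \<Longrightarrow> x (J \<xi>) = (\<Sum>i<l. scale (ip (w i (J \<xi>)) (x (J \<xi>))) (w i (J \<xi>)))"
    "\<And>i j. i < l \<Longrightarrow> j < l \<Longrightarrow> adj (w i) (w j (J \<xi>)) = (if i = j then J \<xi> else 0)"
  proof (rule matrix_units_exist[OF q(1,2) _ \<xi>(2) J\<xi>], goal_cases)
    case (1 y)
    show ?case by (rule q(3)) (fact 1)
  next
    case (2 l w)
    show ?thesis by (rule 2(1)[of l w]) (fact 2)+
  qed
  have ue: "u i (e v) = u i v" if "i < k" for i v
    using fun_cong[OF u(2)[OF that], of "e v"] fun_cong[OF p(4), of v] fun_cong[OF u(2)[OF that], of v]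
    by simp
  have wf: "w i (f v) = w i v" if "i < l" for i v
    using fun_cong[OF w(2)[OF that], of "f v"] fun_cong[OF q(4), of v] fun_cong[OF w(2)[OF that], of v]
    by simp
  have "framed_solution scale ip M J e f \<xi> k l u w"
  proof (intro framed_solution.intro framed_solution_axioms.intro split_solution_axioms, goal_cases)
    case 1 show ?case by (rule \<xi>(3))
  next
    case 2 show ?case by (rule \<xi>(4))
  next
    case (3 i) then show ?case by (rule u(1)[of i])
  next
    case (4 i v) then show ?case by (rule ue[of i v])
  next
    case 5 show ?case by (rule u(3))
  next
    case (6 x) then show ?case by (rule u(4)[of x])
  next
    case (7 i j) then show ?case by (rule u(5)[of i j])
  next
    case (8 i) then show ?case by (rule w(1)[of i])
  next
    case (9 i v) then show ?case by (rule wf[of i v])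
  next
    case 10 show ?case by (rule w(3))
  next
    case (11 x) then show ?case by (rule w(4)[of x])
  next
    case (12 i j) then show ?case by (rule w(5)[of i j])
  qed
  then show ?thesis by blast
qed

end

section \<open>An orthonormal basis of the range of \<open>e\<close>, and the equality of
  \<open>k\<close> and \<open>l\<close>\<close>

context framed_solution
begin

text \<open>Because \<open>J (J \<xi>) = \<xi>\<close>, passing to \<open>f\<close> and
  \<open>J \<xi>\<close> merely exchanges the frames; every result for the range of \<open>e\<close>
  thereby has a mirror image.\<close>

lemma swap_frame: "framed_solution scale ip M J f e (J \<xi>) l k w u"
proof -
  have J\<xi>: "ip (J \<xi>) (J \<xi>) = 1" "f (J \<xi>) = J \<xi>"
    by (simp_all add: J_ip \<xi>_unit \<xi>_e flip: J_e)
  show ?thesis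
  proof (intro framed_solution.intro framed_solution_axioms.intro swap, unfold JJ, goal_cases)
    case 1 show ?case by (rule J\<xi>(1))
  next
    case 2 show ?case by (rule J\<xi>(2))
  next
    case (3 i) then show ?case by (rule w_M[of i])
  next
    case (4 i v) then show ?case by (rule w_f[of i v])
  next
    case 5 show ?case by (rule w_on)
  next
    case (6 x) then show ?case by (rule w_exp[of x])
  next
    case (7 i j) then show ?case by (rule w_adj[of i j])
  next
    case (8 i) then show ?case by (rule u_M[of i])
  next
    case (9 i v) then show ?case by (rule u_e[of i v])
  next
    case 10 show ?case by (rule u_on)
  next
    case (11 x) then show ?case by (rule u_exp[of x])
  next
    case (12 i j) then show ?case by (rule u_adj[of i j])
  qed
qed

text \<open>Plays the role of the matrix unit in row \<open>i\<close> and column \<open>j\<close> of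
  a \<open>k\<close> by \<open>l\<close> matrix: \<open>M\<close> acts on the row index and
  \<open>J M J\<close> on the column index.\<close>

definition b :: "nat \<Rightarrow> nat \<Rightarrow> 'h" where
  "b i j = u i (J (w j (J \<xi>)))"

lemma b_alt: "i < k \<Longrightarrow> j < l \<Longrightarrow> b i j = J (w j (J (u i \<xi>)))"
  unfolding b_def using u_M w_M comm by blast

lemma e_b: "i < k \<Longrightarrow> e (b i j) = b i j"
  unfolding b_def using e_central[OF u_M] u_e by simp

lemma b_on: "orthonormal ({..<k} \<times> {..<l}) (\<lambda>(i, j). b i j)"
proof -
  have "ip (b i j) (b i' j') = (if i = i' \<and> j = j' then 1 else 0)"
    if ij: "i < k" "j < l" "i' < k" "j' < l" for i j i' j'
  proof -
    have "ip (b i j) (b i' j') = ip (J (w j (J \<xi>))) (adj (u i) (u i' (J (w j' (J \<xi>)))))"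
      unfolding b_def using ij u_M by (simp add: ip_adj_right M_op)
    \<comment> \<open>\<open>J (w j') J\<close> commutes with \<open>M\<close>, so
      \<open>adj (u i) \<circ> u i'\<close> can be applied to \<open>\<xi>\<close> first, where it
      yields \<open>\<xi>\<close> or 0.\<close>
    also have "adj (u i) (u i' (J (w j' (J \<xi>)))) = J (w j' (J (adj (u i) (u i' \<xi>))))"
      using comm[OF M_comp[OF M_adj[OF u_M[OF ij(1)]] u_M[OF ij(3)]] w_M[OF ij(4)], of \<xi>] by simp
    also have "ip (J (w j (J \<xi>))) \<dots> = (if i = i' then ip (w j' (J \<xi>)) (w j (J \<xi>)) else 0)"
      using ij w_M by (simp add: u_adj J_ip J_0 M_0)
    also have "\<dots> = (if i = i' \<and> j = j' then 1 else 0)"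
      using w_on ij by (auto simp: orthonormal_def)
    finally show ?thesis .
  qed
  then show ?thesis unfolding orthonormal_def by auto
qed

text \<open>\<open>x (u i \<xi>)\<close> expands in the basis of \<open>M \<xi>\<close>; the linear
  map \<open>J (w j) J\<close> commutes with \<open>M\<close> and carries this expansion to the
  vectors \<open>b m j\<close>.\<close>

lemma M_b:
  assumes x: "x \<in> M" and ij: "i < k" "j < l"
  shows "x (b i j) = (\<Sum>m<k. scale (ip (u m \<xi>) (x (u i \<xi>))) (b m j))"
proof -
  have xu: "x \<circ> u i \<in> M" using x ij u_M M_comp by blast
  have "x (b i j) = J (w j (J ((x \<circ> u i) \<xi>)))"
    unfolding b_def using comm[OF xu w_M[OF ij(2)]] by simp
  also have "\<dots> = J (w j (J (\<Sum>m<k. scale (ip (u m \<xi>) (x (u i \<xi>))) (u m \<xi>))))"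
    using u_exp[OF xu] by simp
  also have "\<dots> = (\<Sum>m<k. scale (ip (u m \<xi>) (x (u i \<xi>))) (b m j))"
    using ij w_M by (simp add: J_sum J_scale op_sum[OF M_op] M_scaleR b_alt)
  finally show ?thesis .
qed

text \<open>Mirror image of \<open>M_b\<close> in the column index; the coefficients are conjugated
  because \<open>J\<close> is antilinear.\<close>

lemma conj_b:
  assumes x: "x \<in> M" and ij: "i < k" "j < l"
  shows "J (x (J (b i j))) = (\<Sum>m<l. scale (cnj (ip (w m (J \<xi>)) (x (w j (J \<xi>))))) (b i m))"
proof -
  have xw: "x \<circ> w j \<in> M" using x ij w_M M_comp by blast
  have "J (x (J (b i j))) = u i (J (x (w j (J \<xi>))))"
    unfolding b_def using comm[OF u_M[OF ij(1)] x, of "J (w j (J \<xi>))"] by (simp add: JJ)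
  also have "\<dots> = u i (J (\<Sum>m<l. scale (ip (w m (J \<xi>)) (x (w j (J \<xi>)))) (w m (J \<xi>))))"
    using w_exp[OF xw] by simp
  also have "\<dots> = (\<Sum>m<l. scale (cnj (ip (w m (J \<xi>)) (x (w j (J \<xi>))))) (b i m))"
    using ij u_M by (simp add: J_sum J_scale op_sum[OF M_op] M_scaleR b_def)
  finally show ?thesis .
qed

lemma k_pos: "k > 0"
proof (rule ccontr)
  assume "\<not> k > 0"
  then have "\<xi> = 0" using u_exp[OF M_id] by simp
  then show False using \<xi>_unit by simp
qed

lemma l_pos: "l > 0"
  by (rule framed_solution.k_pos[OF swap_frame])

text \<open>By \<open>M_b\<close> and \<open>conj_b\<close> the span of the \<open>b i j\<close> is
  invariant under \<open>M\<close> and \<open>J M J\<close>. It lies in the range of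
  \<open>e\<close> and contains the unit vector \<open>b 0 0\<close>, so
  \<open>invariant_subspace\<close> identifies it with that range.\<close>

lemma b_expand: "e v = (\<Sum>(i, j)\<in>{..<k} \<times> {..<l}. scale (ip (b i j) v) (b i j))"
proof -
  let ?B = "(\<lambda>(i, j). b i j) ` ({..<k} \<times> {..<l})"
  have bB: "b i j \<in> ?B" if "i < k" "j < l" for i j using that by auto
  have "e v \<in> span ?B"
  proof (rule invariant_subspace[of _ "b 0 0"])
    show "b 0 0 \<in> span ?B" using k_pos l_pos bB by (intro span_base) auto
    have "ip (b 0 0) (b 0 0) = 1"
      using b_on k_pos l_pos unfolding orthonormal_def by auto
    then show "b 0 0 \<noteq> 0" by auto
    show "e v = v" if "v \<in> span ?B" for v
      using that
    proof (induction v rule: span_induct)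
      case base
      show ?case unfolding subspace_def by (simp add: M_add[OF eM] M_scaleR[OF eM] M_0[OF eM])
    qed (auto simp: e_b)
    fix x v assume x: "x \<in> M" and v: "v \<in> span ?B"
    from v show "x v \<in> span ?B"
    proof (induction v rule: span_induct)
      case base
      show ?case unfolding subspace_def by (simp add: M_add[OF x] M_scaleR[OF x] M_0[OF x] span_add span_scale span_zero)
    next
      case (step y)
      then obtain i j where ij: "i < k" "j < l" "y = b i j" by auto
      show ?case
        unfolding ij(3) M_b[OF x ij(1,2)]
        by (rule span_sum, rule span_scale, rule span_base, rule bB) (use ij in auto)
    qed
  next
    fix x v assume x: "x \<in> M" and v: "v \<in> span ?B"
    from v show "J (x (J v)) \<in> span ?B"
    proof (induction v rule: span_induct)
      case base
      show ?case unfolding subspace_def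
        by (simp add: J_add J_scale J_0 M_add[OF x] M_scaleR[OF x] M_0[OF x] span_add span_scale span_zero)
    next
      case (step y)
      then obtain i j where ij: "i < k" "j < l" "y = b i j" by auto
      show ?case
        unfolding ij(3) conj_b[OF x ij(1,2)]
        by (rule span_sum, rule span_scale, rule span_base, rule bB) (use ij in auto)
    qed
  qed simp
  have ip_be: "ip (b i j) (e v) = ip (b i j) v" if "i < k" for i j
    using ip_adj_right[OF M_op[OF eM], of "b i j" v] e_b[OF that] by (simp add: e_adj)
  have "e v = (\<Sum>s\<in>{..<k} \<times> {..<l}. scale (ip ((\<lambda>(i, j). b i j) s) (e v)) ((\<lambda>(i, j). b i j) s))"
    by (rule orthonormal_expand[OF b_on _ \<open>e v \<in> span ?B\<close>]) simp
  also have "\<dots> = (\<Sum>(i, j)\<in>{..<k} \<times> {..<l}. scale (ip (b i j) v) (b i j))"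
    by (rule sum.cong) (auto simp: ip_be)
  finally show ?thesis .
qed

text \<open>If \<open>\<xi>'\<close> separates \<open>M\<close>, the \<open>k\<^sup>2\<close> vectors \<open>u\<^sub>m u\<^sub>i* \<xi>'\<close> are linearly independent in
  the \<open>kl\<close>-dimensional space \<open>eH\<close>.\<close>

lemma k_le_l: "k \<le> l"
proof -
  from sep obtain \<xi>' where \<xi>': "\<forall>x\<in>M. x \<xi>' = 0 \<longrightarrow> x = (\<lambda>v. 0)" ..
  define g where "g = (\<lambda>(m, i). u m (adj (u i) \<xi>'))"
  let ?I = "{..<k} \<times> {..<k}"
  let ?B = "(\<lambda>(i, j). b i j) ` ({..<k} \<times> {..<l})"
  have "card ?I \<le> card ?B"
  proof (rule independent_family_card_le[where f = g])
    have "g (m, i) \<in> span ?B" if "m < k" "i < k" for m i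
    proof -
      have "e (g (m, i)) = g (m, i)"
        using e_central[OF u_M[OF that(1)]] u_e[OF that(1)] by (simp add: g_def)
      moreover have "e (g (m, i)) \<in> span ?B"
        unfolding b_expand case_prod_unfold
        by (rule span_sum, rule span_scale, rule span_base) auto
      ultimately show ?thesis by simp
    qed
    then show "g ` ?I \<subseteq> span ?B" by auto
  next
    fix c s assume c0: "(\<Sum>s\<in>?I. scale (c s) (g s)) = 0" and s: "s \<in> ?I"
    obtain m i where mi: "s = (m, i)" "m < k" "i < k" using s by auto
    \<comment> \<open>A relation among the \<open>g s\<close> says that \<open>x\<close> annihilates
      the separating vector, so \<open>x = 0\<close>; evaluation at \<open>u i \<xi>\<close> then
      isolates the coefficients with second index \<open>i\<close>.\<close>
    define x where "x v = (\<Sum>s\<in>?I. op_scale (c s) (u (fst s) \<circ> adj (u (snd s))) v)" for v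
    have xM: "x \<in> M"
      unfolding x_def using u_M by (intro M_sum M_scale M_comp M_adj) auto
    have "x \<xi>' = (\<Sum>s\<in>?I. scale (c s) (g s))"
      by (simp add: x_def op_scale_def g_def case_prod_unfold)
    then have x0: "x = (\<lambda>v. 0)" using bspec[OF \<xi>' xM] c0 by simp
    have "x (u i \<xi>) = (\<Sum>(m', j)\<in>?I. if j = i then scale (c (m', j)) (u m' \<xi>) else 0)"
      unfolding x_def op_scale_def
      by (rule sum.cong) (use mi u_M in \<open>auto simp: u_adj M_0\<close>)
    also have "\<dots> = (\<Sum>m'<k. scale (c (m', i)) (u m' \<xi>))"
      using mi by (simp flip: sum.cartesian_product)
    finally have "(\<Sum>m'<k. scale (c (m', i)) (u m' \<xi>)) = 0" by (simp add: x0)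
    from orthonormal_coeff_0[OF u_on _ this, of m] mi show "c s = 0" by simp
  qed auto
  also have "\<dots> \<le> card ({..<k} \<times> {..<l})" by (rule card_image_le) simp
  finally show ?thesis using k_pos by simp
qed

lemma k_eq_l: "k = l"
  using k_le_l framed_solution.k_le_l[OF swap_frame] by simp

end

section \<open>The matrix model\<close>

lemma dim_mat_adjoint [simp]: "dim_row (mat_adjoint A) = dim_col A" "dim_col (mat_adjoint A) = dim_row A"
  by (simp_all add: mat_adjoint_def)

lemma mat_adjoint_carrier [simp]: "A \<in> carrier_mat m n \<Longrightarrow> mat_adjoint A \<in> carrier_mat n m"
  by (metis carrier_matD carrier_matI dim_mat_adjoint)

lemma index_mat_adjoint [simp]:
  "i < dim_col A \<Longrightarrow> j < dim_row A \<Longrightarrow> mat_adjoint A $$ (i, j) = conjugate (A $$ (j, i))"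
  by (simp add: mat_adjoint_def mat_of_rows_index)

lemma mat_adjoint_adjoint [simp]: "mat_adjoint (mat_adjoint A) = A"
  by (rule eq_matI) simp_all

lemma mat_adjoint_one [simp]: "mat_adjoint (1\<^sub>m k) = (1\<^sub>m k :: complex mat)"
  by (rule eq_matI) auto

lemma mat_adjoint_smult: "mat_adjoint (c \<cdot>\<^sub>m A) = cnj c \<cdot>\<^sub>m mat_adjoint (A :: complex mat)"
  by (rule eq_matI) simp_all

lemma mat_adjoint_add:
  "A \<in> carrier_mat m n \<Longrightarrow> B \<in> carrier_mat m n \<Longrightarrow>
    mat_adjoint (A + B) = mat_adjoint A + mat_adjoint (B :: complex mat)"
  by (rule eq_matI) auto

lemma mat_adjoint_mult:
  fixes A B :: "complex mat"
  assumes "A \<in> carrier_mat m n" "B \<in> carrier_mat n p"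
  shows "mat_adjoint (A * B) = mat_adjoint B * mat_adjoint A"
  using assms by (intro eq_matI) (auto simp: scalar_prod_def mult.commute intro!: sum.cong)

lemma mat_trace_adjoint_mult:
  assumes "A \<in> carrier_mat k k" "B \<in> carrier_mat k k"
  shows "mat_trace (mat_adjoint A * B) = (\<Sum>(i, j)\<in>{..<k} \<times> {..<k}. cnj (A $$ (i, j)) * B $$ (i, j))"
proof -
  have "mat_trace (mat_adjoint A * B) = (\<Sum>j<k. \<Sum>i<k. cnj (A $$ (i, j)) * B $$ (i, j))"
    using assms unfolding mat_trace_def
    by (auto simp: scalar_prod_def lessThan_atLeast0 intro!: sum.cong)
  then show ?thesis
    by (subst (asm) sum.swap) (simp add: sum.cartesian_product)
qed

text \<open>Compares row 0 of \<open>E * C\<close> and \<open>C * E\<close> for the matrix unit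
  \<open>E\<close> with its 1 in position \<open>(0, i)\<close>: in column \<open>j\<close> the
  former has \<open>C $$ (i, j)\<close>, the latter \<open>C $$ (0, 0)\<close> if
  \<open>j = i\<close> and 0 otherwise.\<close>

lemma central_mat_scalar:
  assumes C: "C \<in> carrier_mat k k" and comm: "\<And>A. A \<in> carrier_mat k k \<Longrightarrow> A * C = C * A"
  shows "\<exists>z. C = z \<cdot>\<^sub>m (1\<^sub>m k :: complex mat)"
proof (rule exI[of _ "C $$ (0, 0)"], rule eq_matI)
  fix i j assume ij: "i < dim_row (C $$ (0, 0) \<cdot>\<^sub>m (1\<^sub>m k :: complex mat))"
    "j < dim_col (C $$ (0, 0) \<cdot>\<^sub>m (1\<^sub>m k :: complex mat))"
  then have ij: "i < k" "j < k" "0 < k" by auto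
  define E where "E = mat k k (\<lambda>(r, s). if r = 0 \<and> s = i then 1 else (0 :: complex))"
  have E: "E \<in> carrier_mat k k" by (simp add: E_def)
  have "(E * C) $$ (0, j) = (\<Sum>s<k. if s = i then C $$ (s, j) else 0)"
    using C ij unfolding E_def
    by (simp add: scalar_prod_def lessThan_atLeast0 if_distrib[of "\<lambda>x. x * _"] if_distrib[of "\<lambda>x. _ * x"]
        cong: if_cong)
  moreover have "(C * E) $$ (0, j) = (\<Sum>s<k. if s = 0 then (if j = i then C $$ (0, s) else 0) else 0)"
    using C ij unfolding E_def
    by (simp add: scalar_prod_def lessThan_atLeast0 if_distrib[of "\<lambda>x. x * _"] if_distrib[of "\<lambda>x. _ * x"]
        cong: if_cong)
  ultimately show "C $$ (i, j) = (C $$ (0, 0) \<cdot>\<^sub>m 1\<^sub>m k) $$ (i, j)"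
    using comm[OF E] ij by (auto split: if_splits)
qed (use C in auto)

lemma hilbert_schmidt_eq:
  assumes "m \<in> mat_pairs k" "m' \<in> mat_pairs k"
  shows "hilbert_schmidt m m' =
    (\<Sum>(i, j)\<in>{..<k} \<times> {..<k}. cnj (fst m $$ (i, j)) * fst m' $$ (i, j)) +
    (\<Sum>(i, j)\<in>{..<k} \<times> {..<k}. cnj (snd m $$ (i, j)) * snd m' $$ (i, j))"
  using assms unfolding hilbert_schmidt_def mat_pairs_def
  by (auto simp: mat_trace_adjoint_mult)

lemma hilbert_schmidt_left_mult:
  assumes "m \<in> mat_pairs k" "x \<in> mat_pairs k" "y \<in> mat_pairs k"
  shows "hilbert_schmidt (left_mult m x) y =
    hilbert_schmidt x (left_mult (mat_adjoint (fst m), mat_adjoint (snd m)) y)"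
  using assms unfolding hilbert_schmidt_def mat_pairs_def left_mult_def
  by (auto simp: mat_adjoint_mult assoc_mult_mat[of _ k k _ k _ k])

lemma hilbert_schmidt_swap_adjoint:
  assumes "x \<in> mat_pairs k" "y \<in> mat_pairs k"
  shows "hilbert_schmidt (swap_adjoint x) (swap_adjoint y) = hilbert_schmidt y x"
proof -
  \<comment> \<open>Cyclicity of the trace for this product: both sides are the same double sum over
    entries, taken in opposite orders.\<close>
  have *: "mat_trace (A * mat_adjoint B) = mat_trace (mat_adjoint B * A)"
    if A: "A \<in> carrier_mat k k" and B: "B \<in> carrier_mat k k" for A B :: "complex mat"
  proof -
    have "mat_trace (mat_adjoint (mat_adjoint A) * mat_adjoint B) =
        (\<Sum>i<k. \<Sum>j<k. cnj (mat_adjoint A $$ (i, j)) * mat_adjoint B $$ (i, j))"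
      using A B by (subst mat_trace_adjoint_mult[of _ k]) (simp_all only: sum.cartesian_product mat_adjoint_carrier)
    also have "\<dots> = (\<Sum>i<k. \<Sum>j<k. cnj (B $$ (j, i)) * A $$ (j, i))"
      using A B by (intro sum.cong refl) auto
    also have "\<dots> = mat_trace (mat_adjoint B * A)"
      using A B by (subst sum.swap) (simp add: mat_trace_adjoint_mult[of _ k] sum.cartesian_product)
    finally show ?thesis by simp
  qed
  show ?thesis
    using assms by (auto simp: hilbert_schmidt_def swap_adjoint_def mat_pairs_def *)
qed

lemma sum_bool_times:
  "(\<Sum>s\<in>UNIV \<times> A. h s) = (\<Sum>s\<in>A. h (True, s)) + (\<Sum>s\<in>A. h (False, s))"
  for h :: "bool \<times> 'b \<Rightarrow> 'c :: comm_monoid_add"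
proof -
  have "(\<Sum>s\<in>UNIV \<times> A. h s) = (\<Sum>b\<in>UNIV. \<Sum>s\<in>A. h (b, s))"
    by (simp add: sum.cartesian_product)
  then show ?thesis by (simp add: UNIV_bool add.commute)
qed

section \<open>Coordinates in an orthonormal basis indexed by the entries of two matrices\<close>

context finite_dim_hilbert_space
begin

lemma parseval:
  assumes "orthonormal I g" "finite I" "span (g ` I) = UNIV"
  shows "ip v w = (\<Sum>s\<in>I. cnj (ip (g s) v) * ip (g s) w)"
proof -
  have "w = (\<Sum>s\<in>I. scale (ip (g s) w) (g s))"
    by (rule orthonormal_expand[OF assms(1,2)]) (simp add: assms(3))
  then have "ip v w = ip v (\<Sum>s\<in>I. scale (ip (g s) w) (g s))" by simp
  also have "\<dots> = (\<Sum>s\<in>I. cnj (ip (g s) v) * ip (g s) w)"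
    by (simp add: ip_sum_right ip_scale_right flip: ip_commute) (simp add: mult.commute)
  finally show ?thesis .
qed

text \<open>The boolean index selects the summand, \<open>True\<close> for the first; the other two
  are row and column.\<close>

definition coordinates :: "nat \<Rightarrow> (bool \<times> nat \<times> nat \<Rightarrow> 'h) \<Rightarrow> 'h \<Rightarrow> mat_pair" where
  "coordinates k g v =
    (mat k k (\<lambda>(i, j). ip (g (True, i, j)) v), mat k k (\<lambda>(i, j). ip (g (False, i, j)) v))"

lemma unitary_coordinates:
  assumes on: "orthonormal (UNIV \<times> {..<k} \<times> {..<k}) g"
    and sp: "span (g ` (UNIV \<times> {..<k} \<times> {..<k})) = UNIV"
  shows "unitary_onto_mat_pairs k (coordinates k g)"
proof -
  let ?I = "(UNIV :: bool set) \<times> {..<k} \<times> {..<k}"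
  let ?U = "coordinates k g"
  have U_in: "?U v \<in> mat_pairs k" for v
    by (simp add: coordinates_def mat_pairs_def)
  have expand: "v = (\<Sum>s\<in>?I. scale (ip (g s) v) (g s))" for v
    by (rule orthonormal_expand[OF on]) (simp_all add: sp)
  have "inj ?U"
  proof (rule injI)
    fix v w assume eq: "?U v = ?U w"
    have "ip (g (True, i, j)) v = ip (g (True, i, j)) w" "ip (g (False, i, j)) v = ip (g (False, i, j)) w"
      if "i < k" "j < k" for i j
      using arg_cong[OF eq, of "\<lambda>m. fst m $$ (i, j)"] arg_cong[OF eq, of "\<lambda>m. snd m $$ (i, j)"] that
      by (simp_all add: coordinates_def)
    then have *: "ip (g s) v = ip (g s) w" if "s \<in> ?I" for s
      using that by (cases s; cases "fst s") auto
    have "v = (\<Sum>s\<in>?I. scale (ip (g s) v) (g s))" by (rule expand)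
    also have "\<dots> = (\<Sum>s\<in>?I. scale (ip (g s) w) (g s))" by (rule sum.cong) (simp_all only: *)
    also have "\<dots> = w" by (rule expand[symmetric])
    finally show "v = w" .
  qed
  moreover have "range ?U = mat_pairs k"
  proof
    show "range ?U \<subseteq> mat_pairs k" using U_in by auto
    show "mat_pairs k \<subseteq> range ?U"
    proof
      fix m assume m: "m \<in> mat_pairs k"
      define v where "v = (\<Sum>s\<in>?I. scale (if fst s then fst m $$ snd s else snd m $$ snd s) (g s))"
      have v: "ip (g s) v = (if fst s then fst m $$ snd s else snd m $$ snd s)" if "s \<in> ?I" for s
        unfolding v_def by (rule orthonormal_sum[OF on _ that]) simp
      have "?U v = m"
        using m by (auto simp: coordinates_def mat_pairs_def v intro!: prod_eqI eq_matI)
      then show "m \<in> range ?U" by blast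
    qed
  qed
  moreover have "?U (v + w) = (fst (?U v) + fst (?U w), snd (?U v) + snd (?U w))" for v w
    by (auto simp: coordinates_def ip_add_right intro!: eq_matI)
  moreover have "?U (scale c v) = (c \<cdot>\<^sub>m fst (?U v), c \<cdot>\<^sub>m snd (?U v))" for c v
    by (auto simp: coordinates_def ip_scale_right intro!: eq_matI)
  moreover have "hilbert_schmidt (?U v) (?U w) = ip v w" for v w
    unfolding hilbert_schmidt_eq[OF U_in U_in] parseval[OF on _ sp, of v w, simplified] sum_bool_times
    by (auto simp: coordinates_def intro!: arg_cong2[where f = "(+)"] sum.cong)
  ultimately show ?thesis
    unfolding unitary_onto_mat_pairs_def bij_betw_def by blast
qed

lemma orthonormal_spanning_dim:
  assumes on: "orthonormal I g" and fin: "finite I" and sp: "span (g ` I) = UNIV"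
  shows "dim (UNIV :: 'h set) = card I"
proof -
  have inj: "inj_on g I"
    using on unfolding orthonormal_def inj_on_def by (metis (full_types) zero_neq_one)
  have "independent (g ` I)"
  proof
    assume "dependent (g ` I)"
    then obtain c i where c: "i \<in> I" "c (g i) \<noteq> 0" "(\<Sum>v\<in>g ` I. scale (c v) v) = 0"
      unfolding dependent_finite[OF finite_imageI[OF fin]] by auto
    then show False
      using orthonormal_coeff_0[OF on fin, of "\<lambda>i. c (g i)" i] by (simp add: sum.reindex[OF inj])
  qed
  then have "card (g ` I) = dim (UNIV :: 'h set)"
    by (intro basis_card_eq_dim) (auto simp: sp)
  then show ?thesis by (simp add: card_image[OF inj])
qed

text \<open>An orthonormal basis has as many members as two \<open>k\<close> by \<open>k\<close>
  matrices have entries, so it can be reindexed by these entries.\<close>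

lemma unitary_exists:
  assumes n: "dim (UNIV :: 'h set) = 2 * k\<^sup>2"
  obtains U where "unitary_onto_mat_pairs k U"
proof -
  obtain m and f :: "nat \<Rightarrow> 'h" where f: "orthonormal {..<m} f" "span (f ` {..<m}) = UNIV"
    using orthonormal_basis_exists[OF subspace_UNIV] by metis
  let ?I = "(UNIV :: bool set) \<times> {..<k} \<times> {..<k}"
  have card: "card ?I = card {..<m}"
    using orthonormal_spanning_dim[OF f(1) _ f(2)] n
    by (simp add: card_cartesian_product power2_eq_square)
  have "finite ?I" by simp
  from finite_same_card_bij[OF this finite_lessThan card] obtain h where h: "bij_betw h ?I {..<m}" ..
  then have h_inj: "inj_on h ?I" and h_img: "h s \<in> {..<m}" if "s \<in> ?I" for s
    using that by (auto simp: bij_betw_def)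
  have "orthonormal ?I (f \<circ> h)"
    unfolding orthonormal_def
  proof (intro ballI)
    fix s t assume st: "s \<in> ?I" "t \<in> ?I"
    then have "ip (f (h s)) (f (h t)) = (if h s = h t then 1 else 0)"
      using f(1) h_img unfolding orthonormal_def by blast
    then show "ip ((f \<circ> h) s) ((f \<circ> h) t) = (if s = t then 1 else 0)"
      using inj_on_eq_iff[OF h_inj[OF st(1)] st] by simp
  qed
  moreover have "span ((f \<circ> h) ` ?I) = UNIV"
    by (simp only: image_comp[symmetric] bij_betw_imp_surj_on[OF h] f(2))
  ultimately show ?thesis by (rule that[OF unitary_coordinates])
qed

lemma module_op_scale: "module op_scale"
  by unfold_locales (auto simp: op_scale_def fun_eq_iff scale_right_distrib scale_left_distrib)

lemma module_op_scale_real: "module (\<lambda>r::real. op_scale (complex_of_real r))"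
  by unfold_locales (auto simp: op_scale_def fun_eq_iff scale_right_distrib scale_left_distrib)

end

section \<open>The matrix model is an irreducible solution\<close>

lemma smult_smult_mat: "a \<cdot>\<^sub>m (b \<cdot>\<^sub>m A) = (a * b) \<cdot>\<^sub>m (A :: complex mat)"
  by (rule eq_matI) simp_all

locale matrix_model = finite_dim_hilbert_space scale ip
  for scale :: "complex \<Rightarrow> 'h::ab_group_add \<Rightarrow> 'h" and ip :: "'h \<Rightarrow> 'h \<Rightarrow> complex" +
  fixes k :: nat and U :: "'h \<Rightarrow> mat_pair"
  assumes unitary: "unitary_onto_mat_pairs k U" and k_pos: "k > 0"
begin

lemma U_in: "U v \<in> mat_pairs k"
  using unitary unfolding unitary_onto_mat_pairs_def bij_betw_def by auto

lemma U_carrier [simp]: "fst (U v) \<in> carrier_mat k k" "snd (U v) \<in> carrier_mat k k"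
  using U_in[of v] by (auto simp: mat_pairs_def)

lemma U_inj: "U v = U w \<Longrightarrow> v = w"
  using unitary unfolding unitary_onto_mat_pairs_def bij_betw_def by (auto dest: injD)

lemma U_inv: "m \<in> mat_pairs k \<Longrightarrow> U (inv_into UNIV U m) = m"
  using unitary unfolding unitary_onto_mat_pairs_def bij_betw_def by (auto intro: f_inv_into_f)

lemma U_add: "U (v + w) = (fst (U v) + fst (U w), snd (U v) + snd (U w))"
  and U_scale: "U (scale c v) = (c \<cdot>\<^sub>m fst (U v), c \<cdot>\<^sub>m snd (U v))"
  and U_ip: "hilbert_schmidt (U v) (U w) = ip v w"
  using unitary unfolding unitary_onto_mat_pairs_def by auto

definition L :: "complex mat \<Rightarrow> complex mat \<Rightarrow> 'h \<Rightarrow> 'h" where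
  "L a b = inv_into UNIV U \<circ> left_mult (a, b) \<circ> U"

text \<open>Right multiplications enter twice: as opposites of elements of the model algebra
  (\<open>opposite_L\<close>) and as the form of every operator commuting with it
  (\<open>commutes_with_model\<close>).\<close>

definition R :: "complex mat \<Rightarrow> complex mat \<Rightarrow> 'h \<Rightarrow> 'h" where
  "R a b v = inv_into UNIV U (fst (U v) * a, snd (U v) * b)"

abbreviation "J \<equiv> model_J U"

abbreviation "unit_pair \<equiv> inv_into UNIV U (1\<^sub>m k, 1\<^sub>m k)"

lemma U_one: "U unit_pair = (1\<^sub>m k, 1\<^sub>m k)"
  by (rule U_inv) (simp add: mat_pairs_def)

lemma U_L: "a \<in> carrier_mat k k \<Longrightarrow> b \<in> carrier_mat k k \<Longrightarrow>
    U (L a b v) = (a * fst (U v), b * snd (U v))"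
  unfolding L_def by (simp add: left_mult_def case_prod_unfold) (rule U_inv, simp add: mat_pairs_def)

lemma U_R: "a \<in> carrier_mat k k \<Longrightarrow> b \<in> carrier_mat k k \<Longrightarrow>
    U (R a b v) = (fst (U v) * a, snd (U v) * b)"
  unfolding R_def by (rule U_inv) (simp add: mat_pairs_def mult_carrier_mat[of _ k k _ k])

lemma U_J: "U (J v) = (mat_adjoint (snd (U v)), mat_adjoint (fst (U v)))"
  unfolding model_J_def by (simp add: swap_adjoint_def case_prod_unfold) (rule U_inv, simp add: mat_pairs_def)

lemma U_J_swap: "U (J v) = swap_adjoint (U v)"
  by (simp add: U_J swap_adjoint_def case_prod_unfold)

lemma model_algebra_eq: "model_algebra k U = {L a b |a b. a \<in> carrier_mat k k \<and> b \<in> carrier_mat k k}"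
  unfolding model_algebra_def L_def mat_pairs_def by auto

lemma L_in: "a \<in> carrier_mat k k \<Longrightarrow> b \<in> carrier_mat k k \<Longrightarrow> L a b \<in> model_algebra k U"
  unfolding model_algebra_eq by blast

lemma L_op: "a \<in> carrier_mat k k \<Longrightarrow> b \<in> carrier_mat k k \<Longrightarrow> L a b \<in> operators"
  by (intro operatorsI U_inj)
    (simp_all add: U_L U_add U_scale mult_add_distrib_mat[of _ k k _ k] mult_smult_distrib[of _ k k _ k])

lemma R_op: "a \<in> carrier_mat k k \<Longrightarrow> b \<in> carrier_mat k k \<Longrightarrow> R a b \<in> operators"
  by (intro operatorsI U_inj)
    (simp_all add: U_R U_add U_scale add_mult_distrib_mat[of _ k k _ _ k] mult_smult_assoc_mat[of _ k k _ k])

lemma L_R_comm: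
  assumes "a \<in> carrier_mat k k" "b \<in> carrier_mat k k" "c \<in> carrier_mat k k" "d \<in> carrier_mat k k"
  shows "L a b (R c d v) = R c d (L a b v)"
  by (rule U_inj) (use assms in \<open>simp add: U_L U_R assoc_mult_mat[of _ k k _ k _ k]\<close>)

lemma L_comp:
  assumes "a \<in> carrier_mat k k" "b \<in> carrier_mat k k" "c \<in> carrier_mat k k" "d \<in> carrier_mat k k"
  shows "L a b \<circ> L c d = L (a * c) (b * d)"
  by (rule ext, rule U_inj) (use assms in \<open>simp add: U_L assoc_mult_mat[of _ k k _ k _ k]\<close>)

lemma L_add:
  assumes "a \<in> carrier_mat k k" "b \<in> carrier_mat k k" "c \<in> carrier_mat k k" "d \<in> carrier_mat k k"
  shows "L (a + c) (b + d) = (\<lambda>v. L a b v + L c d v)"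
  by (rule ext, rule U_inj) (use assms in \<open>simp add: U_L U_add add_mult_distrib_mat[of _ k k _ _ k]\<close>)

lemma L_scale:
  assumes "a \<in> carrier_mat k k" "b \<in> carrier_mat k k"
  shows "L (c \<cdot>\<^sub>m a) (c \<cdot>\<^sub>m b) = op_scale c (L a b)"
  by (rule ext, rule U_inj)
    (use assms in \<open>simp add: U_L U_scale op_scale_def mult_smult_assoc_mat[of _ k k _ k]\<close>)

lemma L_one: "L (1\<^sub>m k) (1\<^sub>m k) = id"
  by (rule ext, rule U_inj) (simp add: U_L left_mult_one_mat[of _ k k])

lemma L_zero: "L (0\<^sub>m k k) (0\<^sub>m k k) = (\<lambda>v. 0)"
proof -
  have "0 \<cdot>\<^sub>m 1\<^sub>m k = (0\<^sub>m k k :: complex mat)" by (rule eq_matI) auto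
  then show ?thesis using L_scale[of "1\<^sub>m k" "1\<^sub>m k" 0] by (simp add: op_scale_def)
qed

lemma L_inj:
  assumes "L a b = L c d" "a \<in> carrier_mat k k" "b \<in> carrier_mat k k" "c \<in> carrier_mat k k" "d \<in> carrier_mat k k"
  shows "a = c" "b = d"
  using arg_cong[OF assms(1), of "\<lambda>T. U (T unit_pair)"] assms(2-)
  by (simp_all add: U_L U_one right_mult_one_mat[of _ k k])

lemma L_adj:
  assumes "a \<in> carrier_mat k k" "b \<in> carrier_mat k k"
  shows "adj (L a b) = L (mat_adjoint a) (mat_adjoint b)"
proof (rule adj_eqI)
  fix x y
  have "ip (L a b x) y = hilbert_schmidt (left_mult (a, b) (U x)) (U y)"
    using assms by (simp add: U_ip[symmetric] U_L left_mult_def case_prod_unfold)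
  also have "\<dots> = hilbert_schmidt (U x) (left_mult (mat_adjoint a, mat_adjoint b) (U y))"
    using hilbert_schmidt_left_mult[of "(a, b)" k "U x" "U y"] assms U_in by (simp add: mat_pairs_def)
  also have "\<dots> = ip x (L (mat_adjoint a) (mat_adjoint b) y)"
    using assms by (simp add: U_ip[symmetric] U_L left_mult_def case_prod_unfold)
  finally show "ip (L a b x) y = ip x (L (mat_adjoint a) (mat_adjoint b) y)" .
qed

lemma JJ: "J (J v) = v"
  by (rule U_inj) (simp add: U_J)

lemma J_antiunitary: "antiunitary J"
  unfolding antiunitary_def
proof (intro conjI allI)
  show "bij J" by (rule o_bij[of J]) (simp_all add: fun_eq_iff JJ)
  show "J (x + y) = J x + J y" for x y
    by (rule U_inj) (simp add: U_J U_add mat_adjoint_add[of _ k k])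
  show "J (scale c x) = scale (cnj c) (J x)" for c x
    by (rule U_inj) (simp add: U_J U_scale mat_adjoint_smult)
  show "ip (J x) (J y) = ip y x" for x y
    by (simp add: U_ip[symmetric] U_J_swap hilbert_schmidt_swap_adjoint[OF U_in U_in])
qed

lemma inv_J: "inv_into UNIV J = J"
  by (rule inv_unique_comp) (simp_all add: fun_eq_iff JJ)

text \<open>\<open>J\<close> exchanges the summands and, taking adjoints, reverses products. Left
  multiplication therefore becomes right multiplication with exchanged factors:
  \<open>(x, y)\<close> goes to \<open>(x * b, y * a)\<close>.\<close>

lemma opposite_L:
  assumes "a \<in> carrier_mat k k" "b \<in> carrier_mat k k"
  shows "opposite J (L a b) = R b a"
  by (rule ext, rule U_inj)
    (use assms in \<open>simp add: opposite_def inv_J L_adj U_J U_L U_R mat_adjoint_mult[of _ k k _ k]\<close>)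

text \<open>The unit pair is cyclic: every \<open>v\<close> is \<open>L\<close> of its own
  coordinates applied to it. An operator commuting with all \<open>L a b\<close> is thus determined
  by its value there and multiplies by that value from the right.\<close>

lemma commutes_with_model:
  assumes e: "e \<in> operators" and comm: "\<And>a b. a \<in> carrier_mat k k \<Longrightarrow> b \<in> carrier_mat k k \<Longrightarrow> e \<circ> L a b = L a b \<circ> e"
  shows "e v = R (fst (U (e unit_pair))) (snd (U (e unit_pair))) v"
proof -
  have "v = L (fst (U v)) (snd (U v)) unit_pair"
    by (rule U_inj) (simp add: U_L U_one right_mult_one_mat[of _ k k])
  then have "e v = L (fst (U v)) (snd (U v)) (e unit_pair)"
    using fun_cong[OF comm[of "fst (U v)" "snd (U v)"], of unit_pair] by simp
  also have "\<dots> = R (fst (U (e unit_pair))) (snd (U (e unit_pair))) v"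
    by (rule U_inj) (simp add: U_L U_R)
  finally show ?thesis .
qed

lemma model_algebraE:
  assumes "x \<in> model_algebra k U"
  obtains a b where "x = L a b" "a \<in> carrier_mat k k" "b \<in> carrier_mat k k"
  using assms unfolding model_algebra_eq by auto

lemma model_subspace:
  "0 \<in> model_algebra k U"
  "x \<in> model_algebra k U \<Longrightarrow> y \<in> model_algebra k U \<Longrightarrow> x + y \<in> model_algebra k U"
  "x \<in> model_algebra k U \<Longrightarrow> op_scale c x \<in> model_algebra k U"
proof -
  show "0 \<in> model_algebra k U"
    using L_in[of "0\<^sub>m k k" "0\<^sub>m k k"] L_zero by (simp add: zero_fun_def)
  show "x + y \<in> model_algebra k U" if "x \<in> model_algebra k U" "y \<in> model_algebra k U"
    using that
    by (elim model_algebraE) (simp add: plus_fun_def L_in flip: L_add)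
  show "op_scale c x \<in> model_algebra k U" if "x \<in> model_algebra k U"
    using that by (elim model_algebraE) (simp add: L_in flip: L_scale)
qed

lemma real_involutive: "real_involutive_algebra (model_algebra k U)"
  unfolding real_involutive_algebra_def
proof (intro conjI ballI)
  interpret m: module "\<lambda>r::real. op_scale (complex_of_real r)" by (rule module_op_scale_real)
  show "model_algebra k U \<subseteq> operators" by (auto simp: model_algebra_eq L_op)
  show "m.subspace (model_algebra k U)"
    by (rule m.subspaceI) (rule model_subspace; assumption)+
  show "id \<in> model_algebra k U" using L_in[of "1\<^sub>m k" "1\<^sub>m k"] by (simp add: L_one)
  fix x assume x: "x \<in> model_algebra k U"
  then show "adj x \<in> model_algebra k U"
    by (elim model_algebraE) (simp add: L_adj L_in)
  fix y assume "y \<in> model_algebra k U"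
  with x show "x \<circ> y \<in> model_algebra k U"
    by (elim model_algebraE) (simp add: L_comp L_in mult_carrier_mat[of _ k k _ k])
qed

lemma complex_span_model: "complex_span (model_algebra k U) = model_algebra k U"
proof -
  interpret m: module op_scale by (rule module_op_scale)
  have "m.subspace (model_algebra k U)"
    by (rule m.subspaceI) (rule model_subspace; assumption)+
  then show ?thesis unfolding complex_span_def by simp
qed

lemma separating_one: "separating (model_algebra k U) unit_pair"
proof -
  have "v \<in> (\<lambda>T. T unit_pair) ` commutant (model_algebra k U)" for v
  proof (rule image_eqI)
    show "v = R (fst (U v)) (snd (U v)) unit_pair"
      by (rule U_inj) (simp add: U_R U_one left_mult_one_mat[of _ k k])
    show "R (fst (U v)) (snd (U v)) \<in> commutant (model_algebra k U)"
      unfolding commutant_def model_algebra_eq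
      by (auto simp: R_op fun_eq_iff L_R_comm)
  qed
  then show ?thesis unfolding separating_def by auto
qed

text \<open>Positive \<open>k\<close> provides the entry at \<open>(0, 0)\<close>; scalar matrices
  of size 0 all coincide.\<close>

lemma smult_one_inj: "z \<cdot>\<^sub>m 1\<^sub>m k = z' \<cdot>\<^sub>m (1\<^sub>m k :: complex mat) \<Longrightarrow> z = z'"
proof -
  assume "z \<cdot>\<^sub>m 1\<^sub>m k = z' \<cdot>\<^sub>m (1\<^sub>m k :: complex mat)"
  then have "(z \<cdot>\<^sub>m 1\<^sub>m k) $$ (0, 0) = (z' \<cdot>\<^sub>m (1\<^sub>m k :: complex mat)) $$ (0, 0)" by (rule arg_cong)
  then show ?thesis using k_pos by simp
qed

text \<open>A projection commuting with the model algebra is right multiplication by a pair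
  \<open>(c, d)\<close>. Commutation with \<open>J\<close> gives \<open>d = mat_adjoint c\<close>
  and makes \<open>c\<close> central, hence scalar; idempotence leaves the scalars 0 and 1.\<close>

lemma irreducible_model: "irreducible_rep (model_algebra k U) J"
  unfolding irreducible_rep_def
proof (intro allI impI, elim conjE)
  fix e assume proj: "projection e" and comm: "\<forall>x\<in>model_algebra k U. e \<circ> x = x \<circ> e"
    and eJ: "e \<circ> J = J \<circ> e"
  have e_op: "e \<in> operators" and ee: "e \<circ> e = e" using proj by (auto simp: projection_def)
  define c d where "c = fst (U (e unit_pair))" and "d = snd (U (e unit_pair))"
  have cd: "c \<in> carrier_mat k k" "d \<in> carrier_mat k k" by (simp_all add: c_def d_def)
  have e_R: "e v = R c d v" for v
    unfolding c_def d_def by (rule commutes_with_model[OF e_op]) (rule bspec[OF comm L_in])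
  have Ue: "U (e v) = (fst (U v) * c, snd (U v) * d)" for v
    using cd by (simp add: e_R U_R)
  have eJ': "(mat_adjoint (snd (U v)) * c, mat_adjoint (fst (U v)) * d) =
      (mat_adjoint (snd (U v) * d), mat_adjoint (fst (U v) * c))" for v
    using arg_cong[OF fun_cong[OF eJ], of U v] by (simp add: Ue U_J)
  have dc: "d = mat_adjoint c"
    using arg_cong[OF eJ'[of unit_pair], of snd] cd by (simp add: U_one left_mult_one_mat[of _ k k])
  have "a * c = c * a" if a: "a \<in> carrier_mat k k" for a
  proof -
    \<comment> \<open>For this \<open>v\<close>, the first components of
      \<open>e (J v) = J (e v)\<close> are \<open>a * c\<close> and \<open>c * a\<close>.\<close>
    define v where "v = inv_into UNIV U (1\<^sub>m k, mat_adjoint a)"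
    have "U v = (1\<^sub>m k, mat_adjoint a)" unfolding v_def by (rule U_inv) (use a in \<open>simp add: mat_pairs_def\<close>)
    then show ?thesis
      using arg_cong[OF eJ'[of v], of fst] cd a by (simp add: dc mat_adjoint_mult[of _ k k _ k])
  qed
  then obtain z where z: "c = z \<cdot>\<^sub>m 1\<^sub>m k" using central_mat_scalar[OF cd(1)] by blast
  have "c * c = c"
    using arg_cong[OF fun_cong[OF ee], of U unit_pair] cd by (simp add: Ue U_one left_mult_one_mat[of _ k k])
  then have "(z * z) \<cdot>\<^sub>m 1\<^sub>m k = z \<cdot>\<^sub>m (1\<^sub>m k :: complex mat)"
    unfolding z by (simp add: mult_smult_assoc_mat[of _ k k _ k] smult_smult_mat)
  then have "z * z = z" by (rule smult_one_inj)
  then have "z = 0 \<or> z = 1" by simp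
  \<comment> \<open>As \<open>z\<close> is real, \<open>d = mat_adjoint c\<close> is the same scalar
    matrix as \<open>c\<close>, so \<open>e\<close> multiplies both summands by
    \<open>z\<close>.\<close>
  moreover have "U (e v) = U (scale z v)" if "cnj z = z" for v
    using that by (simp add: Ue U_scale dc z mat_adjoint_smult mult_smult_distrib[of _ k k _ k]
        right_mult_one_mat[of _ k k])
  ultimately have "e v = scale z v" for v
    by (intro U_inj) auto
  with \<open>z = 0 \<or> z = 1\<close> show "e = (\<lambda>v. 0) \<or> e = id"
    by (auto simp: fun_eq_iff)
qed

lemma center_model: "center (model_algebra k U) = (\<lambda>(z, w). L (z \<cdot>\<^sub>m 1\<^sub>m k) (w \<cdot>\<^sub>m 1\<^sub>m k)) ` UNIV"
proof (intro equalityI subsetI)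
  fix x assume "x \<in> center (model_algebra k U)"
  then have xM: "x \<in> model_algebra k U" and x_comm: "\<And>y. y \<in> model_algebra k U \<Longrightarrow> x \<circ> y = y \<circ> x"
    by (auto simp: center_def)
  obtain a b where x: "x = L a b" and ab: "a \<in> carrier_mat k k" "b \<in> carrier_mat k k"
    using xM unfolding model_algebra_eq by auto
  have comm: "L a b \<circ> L c d = L c d \<circ> L a b" if "c \<in> carrier_mat k k" "d \<in> carrier_mat k k" for c d
    using x_comm[OF L_in[OF that]] by (simp only: x)
  have "c * a = a * c" "d * b = b * d" if "c \<in> carrier_mat k k" "d \<in> carrier_mat k k" for c d
    using L_inj[of "a * c" "b * d" "c * a" "d * b"] comm[OF that] that ab by (simp_all add: L_comp)
  then obtain z w where "a = z \<cdot>\<^sub>m 1\<^sub>m k" "b = w \<cdot>\<^sub>m 1\<^sub>m k"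
    using central_mat_scalar[OF ab(1)] central_mat_scalar[OF ab(2)] ab by (metis (no_types))
  then show "x \<in> (\<lambda>(z, w). L (z \<cdot>\<^sub>m 1\<^sub>m k) (w \<cdot>\<^sub>m 1\<^sub>m k)) ` UNIV" unfolding x by auto
next
  fix x assume "x \<in> (\<lambda>(z, w). L (z \<cdot>\<^sub>m 1\<^sub>m k) (w \<cdot>\<^sub>m 1\<^sub>m k)) ` UNIV"
  then obtain z w where x: "x = L (z \<cdot>\<^sub>m 1\<^sub>m k) (w \<cdot>\<^sub>m 1\<^sub>m k)" by auto
  have comm: "L (z \<cdot>\<^sub>m 1\<^sub>m k) (w \<cdot>\<^sub>m 1\<^sub>m k) \<circ> L c d = L c d \<circ> L (z \<cdot>\<^sub>m 1\<^sub>m k) (w \<cdot>\<^sub>m 1\<^sub>m k)"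
    if "c \<in> carrier_mat k k" "d \<in> carrier_mat k k" for c d
    using that by (simp add: L_comp mult_smult_assoc_mat[of _ k k _ k] mult_smult_distrib[of _ k k _ k]
        left_mult_one_mat[of _ k k] right_mult_one_mat[of _ k k])
  have x_comm: "x \<circ> y = y \<circ> x" if "y \<in> model_algebra k U" for y
    using that
  proof (rule model_algebraE)
    fix c d assume "y = L c d" "c \<in> carrier_mat k k" "d \<in> carrier_mat k k"
    then show ?thesis unfolding x by (simp only: comm[of c d])
  qed
  have "x \<in> model_algebra k U" unfolding x by (rule L_in) simp_all
  then show "x \<in> center (model_algebra k U)"
    unfolding center_def mem_Collect_eq by (intro conjI ballI x_comm)
qed

lemma isomorphic_center: "isomorphic_C_plus_C (center (model_algebra k U))"
  unfolding isomorphic_C_plus_C_def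
proof (rule exI[of _ "\<lambda>(z, w). L (z \<cdot>\<^sub>m 1\<^sub>m k) (w \<cdot>\<^sub>m 1\<^sub>m k)"], intro conjI allI)
  let ?\<phi> = "\<lambda>(z, w). L (z \<cdot>\<^sub>m 1\<^sub>m k) (w \<cdot>\<^sub>m 1\<^sub>m k)"
  have "inj ?\<phi>"
  proof (rule injI, clarify)
    fix z w z' w' assume eq: "L (z \<cdot>\<^sub>m 1\<^sub>m k) (w \<cdot>\<^sub>m 1\<^sub>m k) = L (z' \<cdot>\<^sub>m 1\<^sub>m k) (w' \<cdot>\<^sub>m 1\<^sub>m k)"
    show "z = z' \<and> w = w'"
      by (intro conjI smult_one_inj L_inj[OF eq]) simp_all
  qed
  then show "bij_betw ?\<phi> UNIV (center (model_algebra k U))"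
    unfolding bij_betw_def center_model by simp
  show "?\<phi> (a + c, b + d) = (\<lambda>v. ?\<phi> (a, b) v + ?\<phi> (c, d) v)" for a b c d
    by (simp add: L_add[symmetric] add_smult_distrib_right_mat[of _ k k])
  show "?\<phi> (t * a, t * b) = op_scale t (?\<phi> (a, b))" for t a b
    by (simp add: L_scale[symmetric] smult_smult_mat)
  show "?\<phi> (a * c, b * d) = ?\<phi> (a, b) \<circ> ?\<phi> (c, d)" for a b c d
    by (simp add: L_comp mult_smult_assoc_mat[of _ k k _ k] smult_smult_mat)
  show "?\<phi> (1, 1) = id"
    using L_scale[of "1\<^sub>m k" "1\<^sub>m k" 1] by (simp add: L_one op_scale_def fun_eq_iff)
  show "?\<phi> (cnj a, cnj b) = adj (?\<phi> (a, b))" for a b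
    by (simp add: L_adj mat_adjoint_smult)
qed

lemma model_solution: "irreducible_solution_C_plus_C (model_algebra k U) J"
proof -
  have opp: "x \<circ> opposite J y = opposite J y \<circ> x"
    if xy: "x \<in> model_algebra k U" "y \<in> model_algebra k U" for x y
  proof -
    obtain a b c d where x: "x = L a b" and y: "y = L c d"
      and ab: "a \<in> carrier_mat k k" "b \<in> carrier_mat k k"
      and cd: "c \<in> carrier_mat k k" "d \<in> carrier_mat k k"
      using xy unfolding model_algebra_eq by auto
    show ?thesis
      unfolding x y opposite_L[OF cd] using L_R_comm[OF ab cd(2,1)] by (simp add: fun_eq_iff)
  qed
  have JJ_id: "J \<circ> J = id" by (simp add: fun_eq_iff JJ)
  show ?thesis
    unfolding irreducible_solution_C_plus_C_def irreducible_solution_def complex_span_model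
    by (intro conjI ballI exI[of _ unit_pair] J_antiunitary JJ_id real_involutive opp
        irreducible_model isomorphic_center separating_one)
qed

end

section \<open>Every solution is a matrix model\<close>

context framed_solution
begin

text \<open>Moving \<open>x\<close> to the left as \<open>adj x\<close> allows \<open>M_b\<close> to
  be applied to the basis vector. In coordinates \<open>x\<close> thus acts by left
  multiplication.\<close>

lemma ip_b_M:
  assumes x: "x \<in> M" and ij: "i < k" "j < l"
  shows "ip (b i j) (x v) = (\<Sum>m<k. ip (u i \<xi>) (x (u m \<xi>)) * ip (b m j) v)"
proof -
  have "ip (b i j) (x v) = ip (adj x (b i j)) v"
    using x by (simp add: ip_adj_left M_op)
  also have "\<dots> = (\<Sum>m<k. cnj (ip (u m \<xi>) (adj x (u i \<xi>))) * ip (b m j) v)"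
    by (simp add: M_b[OF M_adj[OF x] ij] ip_sum_left ip_scale_left)
  also have "\<dots> = (\<Sum>m<k. ip (u i \<xi>) (x (u m \<xi>)) * ip (b m j) v)"
    using x by (simp add: ip_adj_left M_op flip: ip_commute)
  finally show ?thesis .
qed

text \<open>\<open>w i f = w i\<close> and centrality of \<open>e\<close> give
  \<open>e (w i) = (w i) e f = 0\<close>; the claim is the adjoint of this identity.\<close>

lemma adj_w_e:
  assumes i: "i < l"
  shows "adj (w i) (e v) = 0"
proof (rule ip_eqI)
  fix x
  have "e (w i x) = w i (e (f x))"
    using e_central[OF w_M[OF i]] w_f[OF i, of x] by metis
  then have "e (w i x) = 0" using w_M[OF i] by (simp add: ef M_0)
  then show "ip x (adj (w i) (e v)) = ip x 0"
    using ip_adj_right[OF M_op[OF eM], of "w i x" v] ip_adj_right[OF M_op[OF w_M[OF i]], of x "e v"]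
    by (simp add: e_adj)
qed

lemma e_u: "i < k \<Longrightarrow> e (u i v) = u i v"
  using e_central[OF u_M, of i v] u_e[of i v] by simp

text \<open>With the products \<open>u m \<circ> adj (u i)\<close> as matrix units, an arbitrary
  matrix is realised by an element of \<open>M\<close> that vanishes on the range of
  \<open>f\<close>.\<close>

definition of_matrix :: "complex mat \<Rightarrow> 'h \<Rightarrow> 'h" where
  "of_matrix a v = (\<Sum>m<k. \<Sum>i<k. op_scale (a $$ (m, i)) (u m \<circ> adj (u i)) v)"

lemma of_matrix_M: "of_matrix a \<in> M"
  unfolding of_matrix_def[abs_def]
  using u_M by (intro M_sum M_scale M_comp M_adj) auto

lemma of_matrix_u:
  assumes "s < k"
  shows "of_matrix a (u s \<xi>) = (\<Sum>m<k. scale (a $$ (m, s)) (u m \<xi>))"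
  unfolding of_matrix_def
proof (rule sum.cong)
  fix m assume "m \<in> {..<k}"
  then have "(\<Sum>i<k. op_scale (a $$ (m, i)) (u m \<circ> adj (u i)) (u s \<xi>)) =
      (\<Sum>i<k. if i = s then scale (a $$ (m, i)) (u m \<xi>) else 0)"
    using assms u_M by (intro sum.cong) (auto simp: op_scale_def u_adj M_0)
  then show "(\<Sum>i<k. op_scale (a $$ (m, i)) (u m \<circ> adj (u i)) (u s \<xi>)) = scale (a $$ (m, s)) (u m \<xi>)"
    using assms by simp
qed simp

lemma of_matrix_f: "of_matrix a (f v) = 0"
proof -
  have "adj (u i) (f v) = 0" if "i < k" for i
    using framed_solution.adj_w_e[OF swap_frame that] .
  then show ?thesis
    unfolding of_matrix_def op_scale_def using u_M by (simp add: M_0)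
qed

lemma ip_of_matrix:
  assumes "r < k" "s < k"
  shows "ip (u r \<xi>) (of_matrix a (u s \<xi>)) = a $$ (r, s)"
  unfolding of_matrix_u[OF assms(2)]
  by (rule orthonormal_sum[OF u_on]) (use assms in auto)

text \<open>The vectors \<open>b\<close> and their mirror images from the swapped frame form an
  orthonormal basis of the whole space. In its coordinates \<open>M\<close> acts by left
  multiplications, \<open>of_matrix\<close> shows that all of them occur, and \<open>J\<close>
  becomes the model involution.\<close>

lemma matrix_model_exists:
  "\<exists>U. unitary_onto_mat_pairs k U \<and> M = model_algebra k U \<and> J = model_J U \<and>
    dim (UNIV :: 'h set) = 2 * k\<^sup>2"
proof -
  interpret s: framed_solution scale ip M J f e "J \<xi>" l k w u by (rule swap_frame)
  note kl = k_eq_l[symmetric]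
  \<comment> \<open>\<open>J\<close> carries one basis to the other with the indices transposed;
    together with antilinearity this is the source of the adjoints in
    \<open>model_J\<close>.\<close>
  have sb: "s.b i j = J (b j i)" if "i < k" "j < k" for i j
    using that by (simp add: s.b_def b_alt kl JJ)
  let ?I = "(UNIV :: bool set) \<times> {..<k} \<times> {..<k}"
  define g where "g = (\<lambda>(t, i, j). if t then b i j else s.b i j)"
  have g_simps: "g (True, i, j) = b i j" "g (False, i, j) = s.b i j" for i j
    by (simp_all add: g_def)
  have b_on': "ip (b i j) (b i' j') = (if i = i' \<and> j = j' then 1 else 0)"
    "ip (s.b i j) (s.b i' j') = (if i = i' \<and> j = j' then 1 else 0)"
    if "i < k" "j < k" "i' < k" "j' < k" for i j i' j'
    using b_on s.b_on that unfolding orthonormal_def by (auto simp: kl)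
  have cross: "ip (b i j) (s.b i' j') = 0" if "i < k" "i' < k" for i j i' j'
  proof -
    have "ip (b i j) (s.b i' j') = ip (e (b i j)) (f (s.b i' j'))"
      using that by (simp add: e_b s.e_b kl)
    also have "\<dots> = 0"
      by (simp add: ip_adj_right[OF M_op[OF eM]] e_adj ef)
    finally show ?thesis .
  qed
  have cross': "ip (s.b i' j') (b i j) = 0" if "i < k" "i' < k" for i j i' j'
    by (subst ip_commute) (simp add: cross[OF that])
  have on: "orthonormal ?I g"
    unfolding orthonormal_def
  proof (intro ballI)
    fix p q assume "p \<in> ?I" "q \<in> ?I"
    then show "ip (g p) (g q) = (if p = q then 1 else 0)"
      by (cases p; cases q) (auto simp: g_def b_on' cross cross')
  qed
  have g_mem: "g s \<in> span (g ` ?I)" if "s \<in> ?I" for s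
    by (rule span_base) (use that in auto)
  have g_span: "b i j \<in> span (g ` ?I)" "s.b i j \<in> span (g ` ?I)" if "i < k" "j < k" for i j
    using g_mem[of "(True, i, j)"] g_mem[of "(False, i, j)"] that by (simp_all add: g_simps)
  have "v \<in> span (g ` ?I)" for v
  proof -
    have "e v \<in> span (g ` ?I)"
      unfolding b_expand case_prod_unfold
      by (rule span_sum, rule span_scale, rule g_span) (auto simp: kl)
    moreover have "f v \<in> span (g ` ?I)"
      unfolding s.b_expand case_prod_unfold
      by (rule span_sum, rule span_scale, rule g_span) (auto simp: kl)
    ultimately show ?thesis using span_add ef_sum by metis
  qed
  then have sp: "span (g ` ?I) = UNIV" by blast
  define U where "U = coordinates k g"
  have unitary: "unitary_onto_mat_pairs k U"
    unfolding U_def by (rule unitary_coordinates[OF on sp])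
  interpret m: matrix_model scale ip k U
    by unfold_locales (use unitary k_pos in auto)
  have U_entries: "fst (U v) = mat k k (\<lambda>(i, j). ip (b i j) v)" "snd (U v) = mat k k (\<lambda>(i, j). ip (s.b i j) v)" for v
    by (simp_all add: U_def coordinates_def g_simps)
  have J_eq: "J = model_J U"
  proof (rule ext, rule m.U_inj, rule prod_eqI)
    fix v
    show "fst (U (J v)) = fst (U (model_J U v))"
    proof -
      have "ip (b i j) (J v) = cnj (ip (s.b j i) v)" if "i < k" "j < k" for i j
        using that by (simp add: sb ip_J[of "b i j"] flip: ip_commute)
      then show ?thesis unfolding m.U_J by (intro eq_matI) (auto simp: U_entries)
    qed
    show "snd (U (J v)) = snd (U (model_J U v))"
    proof -
      have "ip (s.b i j) (J v) = cnj (ip (b j i) v)" if "i < k" "j < k" for i j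
        using that by (simp add: sb J_ip flip: ip_commute)
      then show ?thesis unfolding m.U_J by (intro eq_matI) (auto simp: U_entries)
    qed
  qed
  define mu mw where
    "mu x = mat k k (\<lambda>(i, j). ip (u i \<xi>) (x (u j \<xi>)))" and
    "mw x = mat k k (\<lambda>(i, j). ip (w i (J \<xi>)) (x (w j (J \<xi>))))" for x :: "'h \<Rightarrow> 'h"
  have mu_carrier: "mu x \<in> carrier_mat k k" and mw_carrier: "mw x \<in> carrier_mat k k" for x
    by (simp_all add: mu_def mw_def)
  have x_L: "x = m.L (mu x) (mw x)" if x: "x \<in> M" for x
  proof (rule ext, rule m.U_inj)
    fix v
    have "fst (U (x v)) = mu x * fst (U v)"
      by (rule eq_matI)
        (auto simp: U_entries mu_def ip_b_M[OF x] kl scalar_prod_def lessThan_atLeast0 intro!: sum.cong)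
    moreover have "snd (U (x v)) = mw x * snd (U v)"
      by (rule eq_matI)
        (auto simp: U_entries mw_def s.ip_b_M[OF x] kl scalar_prod_def lessThan_atLeast0 intro!: sum.cong)
    ultimately show "U (x v) = U (m.L (mu x) (mw x) v)"
      unfolding m.U_L[OF mu_carrier mw_carrier] by (rule prod_eqI[of "U (x v)" "(_, _)", simplified fst_conv snd_conv])
  qed
  have "M = model_algebra k U"
  proof (intro equalityI subsetI)
    fix x assume "x \<in> M"
    then show "x \<in> model_algebra k U"
      by (subst x_L) (simp_all add: m.L_in mu_carrier mw_carrier)
  next
    fix x assume "x \<in> model_algebra k U"
    then obtain a c where x: "x = m.L a c" and ac: "a \<in> carrier_mat k k" "c \<in> carrier_mat k k"
      by (rule m.model_algebraE)
    \<comment> \<open>The first summand realises \<open>a\<close> under \<open>e\<close>, the second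
      \<open>c\<close> under \<open>f\<close>, and each vanishes on the other range; so the two
      matrices of \<open>y\<close> are \<open>a\<close> and \<open>c\<close>.\<close>
    define y where "y = (\<lambda>v. of_matrix a v + s.of_matrix c v)"
    have y: "y \<in> M" unfolding y_def by (intro M_plus of_matrix_M s.of_matrix_M)
    have yu: "y (u i \<xi>) = of_matrix a (u i \<xi>)" if "i < k" for i
      using s.of_matrix_f[of c "u i \<xi>"] that by (simp add: y_def e_u)
    have yw: "y (w i (J \<xi>)) = s.of_matrix c (w i (J \<xi>))" if "i < k" for i
      using of_matrix_f[of a "w i (J \<xi>)"] that by (simp add: y_def s.e_u kl)
    have "mu y = a"
      by (rule eq_matI) (use ac in \<open>auto simp: mu_def yu ip_of_matrix\<close>)
    moreover have "mw y = c"
      by (rule eq_matI) (use ac in \<open>auto simp: mw_def yw s.ip_of_matrix[unfolded kl] kl\<close>)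
    ultimately have "y = x" using x_L[OF y] x by simp
    then show "x \<in> M" using y by simp
  qed
  moreover have "dim (UNIV :: 'h set) = 2 * k\<^sup>2"
    using orthonormal_spanning_dim[OF on _ sp] by (simp add: card_cartesian_product power2_eq_square)
  ultimately show ?thesis
    using unitary J_eq by (intro exI[of _ U] conjI)
qed

end

section \<open>The complex span of a solution and its two central projections\<close>

context finite_dim_hilbert_space
begin

text \<open>Closure under products extends from \<open>A\<close> to its span by induction over the
  right factor and then over the left; for adjoints the scalars get conjugated.\<close>

lemma star_algebra_complex_span:
  assumes A: "real_involutive_algebra A"
  shows "star_algebra scale ip (complex_span A)"
proof -
  interpret m: module op_scale by (rule module_op_scale)
  have A_op: "x \<in> operators" and A_adj: "adj x \<in> A" if "x \<in> A" for x
    using A that by (auto simp: real_involutive_algebra_def)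
  have A_comp: "x \<circ> y \<in> A" if "x \<in> A" "y \<in> A" for x y
    using A that by (auto simp: real_involutive_algebra_def)
  have op_plus: "x + y \<in> operators" if "x \<in> operators" "y \<in> operators" for x y
    by (rule operatorsI) (simp_all add: op_add[OF that(1)] op_add[OF that(2)]
        op_scaleR[OF that(1)] op_scaleR[OF that(2)] scale_right_distrib)
  have op_scale_op: "op_scale c x \<in> operators" if "x \<in> operators" for c x
    by (rule operatorsI) (simp_all add: op_scale_def op_add[OF that] op_scaleR[OF that]
        scale_right_distrib mult.commute)
  have op_0: "0 \<in> operators" by (rule operatorsI) simp_all
  have "m.subspace operators"
    by (rule m.subspaceI) (intro op_0 op_plus op_scale_op; assumption)+
  then have "m.span A \<subseteq> operators"
    using A_op by (intro m.span_minimal) auto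
  then have M_op: "x \<in> operators" if "x \<in> m.span A" for x
    using that by blast
  have comp: "x \<circ> y \<in> m.span A" if x: "x \<in> m.span A" and y: "y \<in> m.span A" for x y
    using y
  proof (induction y rule: m.span_induct)
    case base
    have x_op: "x \<in> operators" using x by (rule M_op)
    show ?case
    proof (rule m.subspaceI, goal_cases)
      case 1
      have "x \<circ> (0 :: 'h \<Rightarrow> 'h) = 0" by (simp add: fun_eq_iff op_zero[OF x_op])
      then show ?case by (simp only: mem_Collect_eq m.span_zero)
    next
      case (2 y z)
      have "x \<circ> (y + z) = (x \<circ> y) + (x \<circ> z)" by (simp add: fun_eq_iff op_add[OF x_op])
      then show ?case using 2 by (simp only: mem_Collect_eq m.span_add)
    next
      case (3 c y)
      have "x \<circ> op_scale c y = op_scale c (x \<circ> y)" by (simp add: fun_eq_iff op_scale_def op_scaleR[OF x_op])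
      then show ?case using 3 by (simp only: mem_Collect_eq m.span_scale)
    qed
  next
    case (step y)
    note y = step
    show ?case using x
    proof (induction x rule: m.span_induct)
      case base
      show ?case
      proof (rule m.subspaceI, goal_cases)
        case 1
        have "(0 :: 'h \<Rightarrow> 'h) \<circ> y = 0" by (simp add: fun_eq_iff)
        then show ?case by (simp only: mem_Collect_eq m.span_zero)
      next
        case (2 x z)
        have "(x + z) \<circ> y = (x \<circ> y) + (z \<circ> y)" by (simp add: fun_eq_iff)
        then show ?case using 2 by (simp only: mem_Collect_eq m.span_add)
      next
        case (3 c x)
        have "op_scale c x \<circ> y = op_scale c (x \<circ> y)" by (simp add: fun_eq_iff op_scale_def)
        then show ?case using 3 by (simp only: mem_Collect_eq m.span_scale)
      qed
    next
      case (step x)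
      show ?case using A_comp[OF step y] by (rule m.span_base)
    qed
  qed
  \<comment> \<open>The induction carries membership in \<open>operators\<close> along, because the
    step knows the remaining summand only through its hypothesis and \<open>adj_plus\<close>
    requires an operator.\<close>
  have adj: "x \<in> operators \<and> adj x \<in> m.span A" if "x \<in> m.span A" for x
    using that
  proof (induction x rule: m.span_induct_alt)
    case base
    have "adj 0 = 0" by (rule adj_eqI) simp
    then show ?case by (simp only: m.span_zero op_0)
  next
    case (step c x y)
    have sc: "op_scale c x \<in> operators" using step(1) by (intro op_scale_op A_op)
    have "adj (op_scale c x + y) = op_scale (cnj c) (adj x) + adj y"
      using adj_plus[OF sc conjunct1[OF step(2)]] adj_op_scale[OF A_op[OF step(1)], of c]
      by (simp add: plus_fun_def)
    moreover have "op_scale (cnj c) (adj x) + adj y \<in> m.span A"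
      by (rule m.span_add[OF m.span_scale[OF m.span_base[OF A_adj[OF step(1)]]] conjunct2[OF step(2)]])
    ultimately show ?case using op_plus[OF sc conjunct1[OF step(2)]] by (simp only:)
  qed
  show ?thesis
    unfolding complex_span_def
  proof (unfold_locales, goal_cases)
    case (1 x) then show ?case by (rule M_op)
  next
    case 2 show ?case
      using A by (intro m.span_base) (simp add: real_involutive_algebra_def)
  next
    case (3 x y) then show ?case
      using m.span_add[of x A y] by (simp add: plus_fun_def)
  next
    case (4 x c) then show ?case by (rule m.span_scale)
  next
    case (5 x y) then show ?case by (rule comp)
  next
    case (6 x) then show ?case by (rule adj[THEN conjunct2])
  qed
qed

text \<open>\<open>e\<close> and \<open>f\<close> are the images of \<open>(1, 0)\<close> and
  \<open>(0, 1)\<close> under the isomorphism onto the center, and inherit the relations of these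
  idempotents. The other conditions are transferred from \<open>A\<close> to its complex
  span.\<close>

lemma split_solution_exists:
  assumes "irreducible_solution_C_plus_C A J"
  shows "\<exists>e f. split_solution scale ip (complex_span A) J e f"
proof -
  let ?M = "complex_span A"
  have J: "antiunitary J" and "J \<circ> J = id" and alg: "real_involutive_algebra A"
    and opp: "\<forall>x\<in>A. \<forall>y\<in>A. x \<circ> opposite J y = opposite J y \<circ> x"
    and sep: "\<exists>\<xi>. separating A \<xi>" and irr: "irreducible_rep A J"
    and iso: "isomorphic_C_plus_C (center ?M)"
    using assms unfolding irreducible_solution_C_plus_C_def irreducible_solution_def by auto
  interpret star_algebra scale ip ?M by (rule star_algebra_complex_span[OF alg])
  interpret m: module op_scale by (rule module_op_scale)
  have A_M: "x \<in> ?M" if "x \<in> A" for x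
    unfolding complex_span_def using that by (rule m.span_base)
  note M_induct = m.span_induct_alt[of _ A, folded complex_span_def, consumes 1, case_names base step]
  have JJ: "J (J v) = v" for v using \<open>J \<circ> J = id\<close> by (simp add: fun_eq_iff)
  have inv_J: "inv_into UNIV J = J" using \<open>J \<circ> J = id\<close> by (rule inv_unique_comp) (fact \<open>J \<circ> J = id\<close>)
  have J_add: "J (v + w) = J v + J w" and J_scale: "J (scale c v) = scale (cnj c) (J v)" for c v w
    using J unfolding antiunitary_def by auto
  have J_0: "J 0 = 0" using J_add[of 0 0] by simp
  have comm_A: "x (J (y (J v))) = J (y (J (x v)))" if "x \<in> A" "y \<in> A" for x y v
  proof -
    \<comment> \<open>\<open>opposite\<close> contains an adjoint; applying the assumption to
      \<open>adj y\<close> yields \<open>J y J\<close>.\<close>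
    have "adj y \<in> A" using alg that(2) by (simp add: real_involutive_algebra_def)
    then have "x \<circ> opposite J (adj y) = opposite J (adj y) \<circ> x" using opp that(1) by blast
    then have "(x \<circ> opposite J (adj y)) v = (opposite J (adj y) \<circ> x) v" by (rule fun_cong)
    then show ?thesis
      by (simp add: opposite_def inv_J adj_adj[OF M_op[OF A_M[OF that(2)]]])
  qed
  \<comment> \<open>Both sides are linear in \<open>x\<close> and antilinear in \<open>y\<close>, so
    the identity extends to the span in one variable at a time.\<close>
  have comm: "x (J (y (J v))) = J (y (J (x v)))" if x: "x \<in> ?M" and y: "y \<in> ?M" for x y v
    using y
  proof (induction y arbitrary: v rule: M_induct)
    case base
    show ?case using M_0[OF x] by (simp add: J_0)
  next
    case (step c y z)
    have "x (J (y (J v))) = J (y (J (x v)))" for v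
      using x
    proof (induction x arbitrary: v rule: M_induct)
      case base
      show ?case using M_0[OF A_M[OF step(1)]] by (simp add: J_0)
    next
      case (step c x z)
      then show ?case
        using M_add[OF A_M[OF \<open>y \<in> A\<close>]] M_scaleR[OF A_M[OF \<open>y \<in> A\<close>]]
        by (simp add: op_scale_def J_add J_scale comm_A[OF _ \<open>y \<in> A\<close>])
    qed
    then show ?case
      using step(2) M_add[OF x] M_scaleR[OF x] by (simp add: op_scale_def J_add J_scale)
  qed
  have irr_M: "g = (\<lambda>v. 0) \<or> g = id"
    if "projection g" "\<And>x v. x \<in> ?M \<Longrightarrow> g (x v) = x (g v)" "\<And>v. g (J v) = J (g v)" for g
  proof -
    have "\<forall>x\<in>A. g \<circ> x = x \<circ> g" using that(2)[OF A_M] by (auto simp: fun_eq_iff)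
    moreover have "g \<circ> J = J \<circ> g" using that(3) by (auto simp: fun_eq_iff)
    ultimately show ?thesis using irr that(1) unfolding irreducible_rep_def by blast
  qed
  have sep_M: "\<exists>\<xi>. \<forall>x\<in>?M. x \<xi> = 0 \<longrightarrow> x = (\<lambda>v. 0)"
  proof -
    obtain \<xi> where \<xi>: "(\<lambda>T. T \<xi>) ` commutant A = UNIV"
      using sep unfolding separating_def by blast
    \<comment> \<open>Every \<open>v\<close> is \<open>T \<xi>\<close> with \<open>T\<close> in the
      commutant, so \<open>x v = x (T \<xi>) = T (x \<xi>) = 0\<close>.\<close>
    have "x v = 0" if x: "x \<in> ?M" "x \<xi> = 0" for x v
    proof -
      have "v \<in> (\<lambda>T. T \<xi>) ` commutant A" by (simp add: \<xi>)
      then obtain T where T: "v = T \<xi>" "T \<in> commutant A" by (rule imageE)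
      then have T_op: "T \<in> operators" and T_A: "\<And>y. y \<in> A \<Longrightarrow> T \<circ> y = y \<circ> T"
        by (auto simp: commutant_def)
      have "T (x w) = x (T w)" for w
        using x(1)
      proof (induction x rule: M_induct)
        case base
        show ?case using op_zero[OF T_op] by simp
      next
        case (step c y z)
        then show ?case
          using op_add[OF T_op] op_scaleR[OF T_op] fun_cong[OF T_A[OF step(1)]]
          by (simp add: op_scale_def)
      qed
      then show ?thesis using T(1) x(2) op_zero[OF T_op] by metis
    qed
    then show ?thesis by (intro exI[of _ \<xi>] ballI impI ext)
  qed
  obtain \<phi> :: "complex \<times> complex \<Rightarrow> 'h \<Rightarrow> 'h" where
    bij: "bij_betw \<phi> UNIV (center ?M)"
    and \<phi>_add: "\<forall>a b c d. \<phi> (a + c, b + d) = (\<lambda>v. \<phi> (a, b) v + \<phi> (c, d) v)"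
    and \<phi>_scale: "\<forall>t a b. \<phi> (t * a, t * b) = op_scale t (\<phi> (a, b))"
    and \<phi>_mult: "\<forall>a b c d. \<phi> (a * c, b * d) = \<phi> (a, b) \<circ> \<phi> (c, d)"
    and \<phi>_1: "\<phi> (1, 1) = id"
    and \<phi>_adj: "\<forall>a b. \<phi> (cnj a, cnj b) = adj (\<phi> (a, b))"
    using iso unfolding isomorphic_C_plus_C_def by (elim exE conjE) (rule that)
  have \<phi>_center: "\<phi> p \<in> center ?M" for p
    using bij_betw_apply[OF bij] by simp
  have \<phi>_inj: "\<phi> p \<noteq> \<phi> q" if "p \<noteq> q" for p q
    using bij that unfolding bij_betw_def inj_def by blast
  have \<phi>_0: "\<phi> (0, 0) = (\<lambda>v. 0)"
    using \<phi>_scale[rule_format, of 0 0 0] by (simp add: op_scale_def)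
  have \<phi>_M: "\<phi> p \<in> ?M" for p
    using \<phi>_center[of p] by (simp add: center_def)
  have \<phi>_comm: "\<phi> p (x v) = x (\<phi> p v)" if "x \<in> ?M" for p x v
    using \<phi>_center[of p] that unfolding center_def by (auto dest!: bspec fun_cong)
  have mult: "\<phi> (a, b) (\<phi> (c, d) v) = \<phi> (a * c, b * d) v" for a b c d v
    using fun_cong[OF \<phi>_mult[rule_format, of a c b d], of v] by simp
  have sum: "\<phi> (1, 0) v + \<phi> (0, 1) v = v" for v
    using fun_cong[OF \<phi>_add[rule_format, of 1 0 0 1], of v] by (simp add: \<phi>_1)
  have "split_solution scale ip ?M J (\<phi> (1, 0)) (\<phi> (0, 1))"
  proof (unfold_locales, goal_cases)
    case 1 show ?case by (rule J)
  next
    case (2 v) show ?case by (rule JJ)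
  next
    case (3 x y v) then show ?case by (rule comm)
  next
    case (4 g) show ?case by (rule irr_M) (fact 4)+
  next
    case 5 show ?case by (rule sep_M)
  next
    case 6 show ?case by (rule \<phi>_M)
  next
    case 7 show ?case by (rule \<phi>_M)
  next
    case (8 v) show ?case by (simp add: mult)
  next
    case (9 v) show ?case by (simp add: mult)
  next
    case (10 v) show ?case by (simp add: mult \<phi>_0)
  next
    case (11 v) show ?case by (simp add: mult \<phi>_0)
  next
    case (12 v) show ?case by (rule sum)
  next
    case 13 show ?case using \<phi>_adj[rule_format, of 1 0] by simp
  next
    case 14 show ?case using \<phi>_adj[rule_format, of 0 1] by simp
  next
    case (15 x v) then show ?case by (rule \<phi>_comm)
  next
    case (16 x v) then show ?case by (rule \<phi>_comm)
  next
    case 17 show ?case using \<phi>_inj[of "(1, 0)" "(0, 0)"] by (simp add: \<phi>_0)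
  next
    case 18 show ?case using \<phi>_inj[of "(0, 1)" "(0, 0)"] by (simp add: \<phi>_0)
  qed
  then show ?thesis by (intro exI)
qed

lemma solution_is_model:
  assumes "irreducible_solution_C_plus_C A J"
  obtains k U where "unitary_onto_mat_pairs k U" "complex_span A = model_algebra k U" "J = model_J U"
    "dim (UNIV :: 'h set) = 2 * k\<^sup>2"
proof -
  obtain e f where ef: "split_solution scale ip (complex_span A) J e f"
    using split_solution_exists[OF assms] by (elim exE)
  obtain \<xi> k l u w where fr: "framed_solution scale ip (complex_span A) J e f \<xi> k l u w"
    using split_solution.frame_exists[OF ef] by (elim exE)
  show ?thesis
    using framed_solution.matrix_model_exists[OF fr] by (elim exE conjE) (rule that)
qed

text \<open>Rules out \<open>k = 0\<close> for a nonzero space: pairs of empty matrices have norm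
  0.\<close>

lemma unitary_0:
  assumes "unitary_onto_mat_pairs 0 U"
  shows "(v :: 'h) = 0"
proof -
  have "hilbert_schmidt (U v) (U v) = ip v v" and "range U = mat_pairs 0"
    using assms unfolding unitary_onto_mat_pairs_def bij_betw_def by auto
  moreover have "hilbert_schmidt (U v) (U v) = 0"
    using hilbert_schmidt_eq[of "U v" 0 "U v"] \<open>range U = mat_pairs 0\<close> by auto
  ultimately show ?thesis by simp
qed

end

text \<open>Unitary equivalence is expressed by transport along a unitary \<open>U\<close> onto the
  pairs of matrices. Uniqueness concerns \<open>complex_span A\<close>, since different real
  algebras \<open>A\<close> may have the same complex span.\<close>

theorem proposition2p8:
  fixes scale :: "complex \<Rightarrow> 'h::ab_group_add \<Rightarrow> 'h"
    and ip :: "'h \<Rightarrow> 'h \<Rightarrow> complex"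
    and n :: nat
  assumes hilbert: "finite_dim_hilbert_space scale ip"
    and nonzero: "\<exists>v::'h. v \<noteq> 0"
    and dim: "vector_space.dim scale (UNIV :: 'h set) = n"
  shows
    "((\<exists>A J. finite_dim_hilbert_space.irreducible_solution_C_plus_C scale ip A J)
        \<longleftrightarrow> (\<exists>k. n = 2 * k\<^sup>2))
     \<and>
     (\<forall>k. n = 2 * k\<^sup>2 \<longrightarrow>
        (\<forall>U. finite_dim_hilbert_space.unitary_onto_mat_pairs scale ip k U \<longrightarrow>
             finite_dim_hilbert_space.irreducible_solution_C_plus_C scale ip
               (model_algebra k U) (model_J U)) \<and>
        (\<forall>A J. finite_dim_hilbert_space.irreducible_solution_C_plus_C scale ip A J \<longrightarrow>
             (\<exists>U. finite_dim_hilbert_space.unitary_onto_mat_pairs scale ip k U \<and>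
                  finite_dim_hilbert_space.complex_span scale A = model_algebra k U \<and>
                  J = model_J U)))"
proof -
  interpret finite_dim_hilbert_space scale ip by (rule hilbert)
  have model: "irreducible_solution_C_plus_C (model_algebra k U) (model_J U)"
    if U: "unitary_onto_mat_pairs k U" for k U
  proof -
    have "k > 0" using unitary_0 nonzero U by (cases k) auto
    then interpret matrix_model scale ip k U by unfold_locales (rule U)
    show ?thesis by (rule model_solution)
  qed
  show ?thesis
  proof (intro conjI iffI allI impI)
    assume "\<exists>A J. irreducible_solution_C_plus_C A J"
    then obtain A J where "irreducible_solution_C_plus_C A J" by (elim exE)
    then obtain k U where "unitary_onto_mat_pairs k U" "complex_span A = model_algebra k U"
      "J = model_J U" "dim UNIV = 2 * k\<^sup>2"
      by (rule solution_is_model)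
    then show "\<exists>k. n = 2 * k\<^sup>2" using dim by auto
  next
    assume "\<exists>k. n = 2 * k\<^sup>2"
    then obtain k where "dim UNIV = 2 * k\<^sup>2" using dim by auto
    then obtain U where "unitary_onto_mat_pairs k U" by (rule unitary_exists)
    then show "\<exists>A J. irreducible_solution_C_plus_C A J" by (intro exI) (rule model)
  next
    fix k U assume "unitary_onto_mat_pairs k U"
    then show "irreducible_solution_C_plus_C (model_algebra k U) (model_J U)" by (rule model)
  next
    fix k A J assume k: "n = 2 * k\<^sup>2" and "irreducible_solution_C_plus_C A J"
    from this(2) obtain k' U where U: "unitary_onto_mat_pairs k' U" "complex_span A = model_algebra k' U"
      "J = model_J U" "dim UNIV = 2 * k'\<^sup>2"
      by (rule solution_is_model)
    have "k'\<^sup>2 = k\<^sup>2" using U(4) dim k by simp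
    \<comment> \<open>The dimension determines the size of the matrices, so the size found for this
      solution is the prescribed one.\<close>
    then have "k' = k" by simp
    then show "\<exists>U. unitary_onto_mat_pairs k U \<and> complex_span A = model_algebra k U \<and> J = model_J U"
      using U(1-3) by (intro exI[of _ U] conjI) simp_all
  qed
qed

end
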